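(* 1) The semi-Hopf $*$-operations of $H_1^i$ are of the following two types. Type I: $\Gamma=I\circ\varphi$ with $\varphi\in\mathrm{Aut}_I^S(H_1^i)$, given by $$\Gamma(e_0)=e_0,\ \Gamma(E_0)=\alpha E_1+\beta F_1,\ \Gamma(F_0)=\gamma E_1+\delta F_1,\ \Gamma(C_0)=\lambda C_0,$$ $$\Gamma(e_1)=e_1,\ \Gamma(E_1)=\alpha E_0-\beta F_0,\ \Gamma(F_1)=-\gamma E_0+\delta F_0,\ \Gamma(C_1)=\lambda C_1,$$ where $\alpha=ae^{i\phi}$, $\beta=\pm b\,e^{i(\phi+\psi)/2}$, $\gamma=\pm c\,e^{i(\phi+\psi)/2}$, $\delta=ae^{i\psi}$, $\lambda=\alpha\delta-\beta\gamma=e^{i(\phi+\psi)}$, with $a,b,c\ge0$ fulfilling $a^2-bc=1$. Type II: $\Gamma=I\circ\varphi$ with $\varphi\in\mathrm{Aut}_{II}^S(H_1^i)$, given by $$\Gamma(e_0)=e_1,\ \Gamma(E_0)=\alpha E_0+\beta F_0,\ \Gamma(F_0)=\gamma E_0+\delta F_0,\ \Gamma(C_0)=\lambda C_1,$$ $$\Gamma(e_1)=e_0,\ \Gamma(E_1)=-\alpha E_1+\beta F_1,\ \Gamma(F_1)=\gamma E_1-\delta F_1,\ \Gamma(C_1)=\lambda C_0,$$ where $\alpha=ae^{i\phi}$, $\beta=\pm ib\,e^{i(\phi+\psi)/2}$, $\gamma=\pm ic\,e^{i(\phi+\psi)/2}$, $\delta=ae^{i\psi}$, $\lambda=-(\alpha\delta-\beta\gamma)=-e^{i(\phi+\psi)}$,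 with $a>0$, $b,c\ge0$ fulfilling $a^2+bc=1$. 2) The $*$-operations of type I are in fact the Hopf $*$-operations of $H_1^i$. Indeed they all fulfill $\Delta(\Gamma(a))=(\Gamma\otimes\Gamma)(\Delta(a))$, $a\in H_1^i$, whilst this is the case for none of the $*$-operations of type II. One has thus a four-parameter family of Hopf $*$-operations belonging to the same orbit of the right action of Hopf homomorphisms. The $*$-operation $I$ is obtained by making in type I the choice $\alpha=\delta=1$, $\beta=\gamma=0$, whilst the choice $\alpha=\delta=0$, $\beta=-i$, $\gamma=i$ yields the $*$-operation $e_0\mapsto e_0$, $E_0\mapsto-iF_1$, $F_0\mapsto iE_1$, $C_0\mapsto-C_0$, $e_1\mapsto e_1$, $E_1\mapsto iF_0$, $F_1\mapsto-iE_0$, $C_1\mapsto-C_1$, with $K\mapsto K$, $E\mapsto iKF$, $F\mapsto iEK^{-1}$.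
   Context: $H_1^i$ is the unital associative $\mathbb{C}$-algebra generated by $K,E,F$ with relations $KE=-EK$, $KF=-FK$, $EF=FE$, $E^2=F^2=0$, $K^2=\mathbf 1$. It is a Hopf algebra with $\Delta(K)=K\otimes K$, $\Delta(E)=E\otimes\mathbf 1+K\otimes E$, $\Delta(F)=F\otimes K^{-1}+\mathbf 1\otimes F$, $\varepsilon(K)=1$, $\varepsilon(E)=\varepsilon(F)=0$, $S(K)=K^{-1}$, $S(E)=-K^{-1}E$, $S(F)=-FK$. Put $e_0=\frac{\mathbf 1+K}{2}$, $e_1=\frac{\mathbf 1-K}{2}$, and for $j=0,1$: $E_j=e_jE$, $F_j=e_jF$, $C_j=e_jEF$; these eight elements form a basis of $H_1^i$. $\mathrm{Aut}^S(H_1^i)$ is the group of algebra automorphisms $\varphi$ of $H_1^i$ with $\varphi\circ S=S\circ\varphi$; $\mathrm{Aut}^S_I(H_1^i)$ (resp. $\mathrm{Aut}^S_{II}(H_1^i)$) is the subset of those with $\varphi(e_0)=e_0$ (resp. $\varphi(e_0)=e_1$), and these two subsets exhaust $\mathrm{Aut}^S(H_1^i)$. A $*$-operation is an antilinear, antimultiplicative involution of $H_1^i$. $I$ is the Hopf $*$-operation with $I(K)=K$, $I(E)=E$, $I(F)=F$. A semi-Hopf $*$-operation is an involution of the form $I\circ\varphi$ with $\varphi\in\mathrm{Aut}^S(H_1^i)$. A Hopf $*$-operation is a $*$-operation $\Gamma$ with $\Delta\circ\Gamma=(\Gamma\otimes\Gamma)\circ\Delta$. Hopf homomorphisms are algebra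 morphisms that are also coalgebra morphisms. The phases $\phi,\psi$ are real.
   Formalization: The ± signs of β, γ are independent and enter the constraints: a²−(±b)(±c)=1 (type I), a²+(±b)(±c)=1 (type II), and type II allows a=0. As printed, the example β=−i, γ=i (type I) and the involution α=δ=0, β=γ=i (type II) would be excluded. *)

theory Defs
  imports Complex_Main "HOL-Library.Poly_Mapping"
begin

section \<open>Complex algebras\<close>

text \<open>Associative unital algebras over the complex numbers (the zero algebra is not excluded).\<close>

class complex_algebra = ring + monoid_mult +
  fixes scaleC :: "complex \<Rightarrow> 'a \<Rightarrow> 'a"  (infixr "*\<^sub>C" 75)
  assumes scaleC_add_right: "c *\<^sub>C (x + y) = c *\<^sub>C x + c *\<^sub>C y"
    and scaleC_add_left: "(c + d) *\<^sub>C x = c *\<^sub>C x + d *\<^sub>C x"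
    and scaleC_scaleC: "c *\<^sub>C d *\<^sub>C x = (c * d) *\<^sub>C x"
    and scaleC_one [simp]: "1 *\<^sub>C x = x"
    and scaleC_mult_left: "(c *\<^sub>C x) * y = c *\<^sub>C (x * y)"
    and scaleC_mult_right: "x * (c *\<^sub>C y) = c *\<^sub>C (x * y)"
begin

lemma scaleC_zero_left [simp]: "0 *\<^sub>C x = 0"
  using scaleC_add_left[of 0 0 x] by simp

lemma scaleC_zero_right [simp]: "c *\<^sub>C 0 = 0"
  using scaleC_add_right[of c 0 0] by simp

lemma scaleC_minus_left: "(- c) *\<^sub>C x = - (c *\<^sub>C x)"
  using scaleC_add_left[of "- c" c x] by (simp add: eq_neg_iff_add_eq_0)

lemma scaleC_minus_right: "c *\<^sub>C (- x) = - (c *\<^sub>C x)"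
  using scaleC_add_right[of c "- x" x] by (simp add: eq_neg_iff_add_eq_0)

lemma scaleC_diff_right: "c *\<^sub>C (x - y) = c *\<^sub>C x - c *\<^sub>C y"
  using scaleC_add_right[of c x "- y"] by (simp add: scaleC_minus_right)

end

instantiation complex :: complex_algebra
begin
definition scaleC_complex :: "complex \<Rightarrow> complex \<Rightarrow> complex"
  where "scaleC_complex c x = c * x"
instance by standard (auto simp: scaleC_complex_def algebra_simps)
end

text \<open>\<open>semilinear id\<close> is linearity, \<open>semilinear cnj\<close> is antilinearity.\<close>

definition semilinear ::
    "(complex \<Rightarrow> complex) \<Rightarrow> ('a::complex_algebra \<Rightarrow> 'b::complex_algebra) \<Rightarrow> bool" where
  "semilinear \<sigma> f \<longleftrightarrow>
     (\<forall>x y. f (x + y) = f x + f y) \<and> (\<forall>c x. f (c *\<^sub>C x) = \<sigma> c *\<^sub>C f x)"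

definition antimultiplicative :: "('a::complex_algebra \<Rightarrow> 'b::complex_algebra) \<Rightarrow> bool" where
  "antimultiplicative f \<longleftrightarrow> (\<forall>x y. f (x * y) = f y * f x)"

definition algebra_hom :: "('a::complex_algebra \<Rightarrow> 'b::complex_algebra) \<Rightarrow> bool" where
  "algebra_hom f \<longleftrightarrow> semilinear id f \<and> (\<forall>x y. f (x * y) = f x * f y) \<and> f 1 = 1"

definition algebra_antihom :: "('a::complex_algebra \<Rightarrow> 'b::complex_algebra) \<Rightarrow> bool" where
  "algebra_antihom f \<longleftrightarrow> semilinear id f \<and> antimultiplicative f \<and> f 1 = 1"

definition star_op :: "('a::complex_algebra \<Rightarrow> 'a) \<Rightarrow> bool" where
  "star_op \<Gamma> \<longleftrightarrow> semilinear cnj \<Gamma> \<and> antimultiplicative \<Gamma> \<and> (\<forall>x. \<Gamma> (\<Gamma> x) = x)"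

section \<open>Monoid algebras and their quotients\<close>

text \<open>
  For a monoid \<open>M\<close>, written additively because this is what \<open>Poly_Mapping\<close> expects (commutativity
  is not required), \<open>M \<Rightarrow>\<^sub>0 complex\<close> is the monoid algebra of \<open>M\<close>.
\<close>

inductive_set two_sided_ideal :: "'a::ring_1 set \<Rightarrow> 'a set" for R where
  gen: "r \<in> R \<Longrightarrow> r \<in> two_sided_ideal R"
| zero: "0 \<in> two_sided_ideal R"
| add: "x \<in> two_sided_ideal R \<Longrightarrow> y \<in> two_sided_ideal R \<Longrightarrow> x + y \<in> two_sided_ideal R"
| mult_left: "x \<in> two_sided_ideal R \<Longrightarrow> a * x \<in> two_sided_ideal R"
| mult_right: "x \<in> two_sided_ideal R \<Longrightarrow> x * a \<in> two_sided_ideal R"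

definition ideal_cong :: "'a::ring_1 set \<Rightarrow> 'a \<Rightarrow> 'a \<Rightarrow> bool" where
  "ideal_cong R x y \<longleftrightarrow> x - y \<in> two_sided_ideal R"

lemma two_sided_ideal_uminus: "x \<in> two_sided_ideal R \<Longrightarrow> - x \<in> two_sided_ideal R"
  using two_sided_ideal.mult_left[of x R "-1"] by simp

lemma ideal_cong_refl: "ideal_cong R x x"
  by (simp add: ideal_cong_def two_sided_ideal.zero)

lemma ideal_cong_eqI: "x = y \<Longrightarrow> ideal_cong R x y"
  by (simp add: ideal_cong_refl)

lemma equivp_ideal_cong: "equivp (ideal_cong R)"
proof (rule equivpI)
  show "reflp (ideal_cong R)"
    by (simp add: reflp_def ideal_cong_refl)
  show "symp (ideal_cong R)"
    unfolding symp_def ideal_cong_def using two_sided_ideal_uminus by fastforce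
  show "transp (ideal_cong R)"
    unfolding transp_def ideal_cong_def using two_sided_ideal.add by fastforce
qed

lemma ideal_cong_add:
  "ideal_cong R x x' \<Longrightarrow> ideal_cong R y y' \<Longrightarrow> ideal_cong R (x + y) (x' + y')"
  unfolding ideal_cong_def using two_sided_ideal.add[of "x - x'" R "y - y'"]
  by (simp add: algebra_simps)

lemma ideal_cong_uminus: "ideal_cong R x x' \<Longrightarrow> ideal_cong R (- x) (- x')"
  unfolding ideal_cong_def using two_sided_ideal_uminus[of "x - x'" R] by simp

lemma ideal_cong_mult:
  assumes "ideal_cong R x x'" "ideal_cong R y y'"
  shows "ideal_cong R (x * y) (x' * y')"
proof -
  have "(x - x') * y + x' * (y - y') \<in> two_sided_ideal R"
    using assms unfolding ideal_cong_def
    by (blast intro: two_sided_ideal.add two_sided_ideal.mult_left two_sided_ideal.mult_right)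
  then show ?thesis
    unfolding ideal_cong_def by (simp add: algebra_simps)
qed

lemma ideal_cong_diff:
  "ideal_cong R x x' \<Longrightarrow> ideal_cong R y y' \<Longrightarrow> ideal_cong R (x - y) (x' - y')"
  using ideal_cong_add[of R x x' "- y" "- y'"] ideal_cong_uminus[of R y y'] by simp

definition const_mult :: "complex \<Rightarrow> ('m::monoid_add \<Rightarrow>\<^sub>0 complex) \<Rightarrow> 'm \<Rightarrow>\<^sub>0 complex" where
  "const_mult c p = Poly_Mapping.single 0 c * p"

lemma monoid_algebra_induct [case_names zero single add]:
  fixes p :: "'m \<Rightarrow>\<^sub>0 complex"
  assumes "P 0" "\<And>m c. P (Poly_Mapping.single m c)" "\<And>p q. P p \<Longrightarrow> P q \<Longrightarrow> P (p + q)"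
  shows "P p"
proof (induction p rule: update_induct)
  case const
  show ?case using assms(1) by simp
next
  case (update f a b)
  have "Poly_Mapping.update a b f = f + Poly_Mapping.single a b"
    using update(1)
    by (intro poly_mapping_eqI)
      (auto simp: lookup_update lookup_add lookup_single when_def in_keys_iff)
  then show ?case using assms(2,3) update by simp
qed

lemma const_mult_single: "const_mult c (Poly_Mapping.single m d) = Poly_Mapping.single m (c * d)"
  by (simp add: const_mult_def mult_single)

lemma const_mult_add: "const_mult c (p + q) = const_mult c p + const_mult c q"
  by (simp add: const_mult_def algebra_simps)

lemma const_mult_commute: "p * Poly_Mapping.single 0 (c::complex) = Poly_Mapping.single 0 c * p"
  by (induction p rule: monoid_algebra_induct)
    (auto simp: mult_single mult.commute distrib_left distrib_right)

lemma const_mult_right: "p * const_mult c q = const_mult c (p * q)"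
  unfolding const_mult_def mult.assoc[symmetric] const_mult_commute ..

lemma monoid_algebra_laws:
  fixes p q r :: "'m::monoid_add \<Rightarrow>\<^sub>0 complex"
  shows "p + q + r = p + (q + r)" "p + q = q + p" "0 + p = p" "- p + p = 0" "p - q = p + - q"
    "p * q * r = p * (q * r)" "(p + q) * r = p * r + q * r" "p * (q + r) = p * q + p * r"
    "1 * p = p" "p * 1 = p"
    "const_mult c (p + q) = const_mult c p + const_mult c q"
    "const_mult (c + d) p = const_mult c p + const_mult d p"
    "const_mult c (const_mult d p) = const_mult (c * d) p"
    "const_mult 1 p = p"
    "const_mult c p * q = const_mult c (p * q)"
    "p * const_mult c q = const_mult c (p * q)"
proof -
  show "const_mult (c + d) p = const_mult c p + const_mult d p"
    unfolding const_mult_def single_add by (rule distrib_right)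
  have "Poly_Mapping.single 0 c * Poly_Mapping.single 0 d =
      (Poly_Mapping.single 0 (c * d) :: 'm \<Rightarrow>\<^sub>0 complex)"
    by (simp add: mult_single)
  then show "const_mult c (const_mult d p) = const_mult (c * d) p"
    unfolding const_mult_def by (simp flip: mult.assoc)
  show "const_mult 1 p = p"
    by (simp add: const_mult_def)
  show "const_mult c p * q = const_mult c (p * q)"
    by (simp add: const_mult_def mult.assoc)
qed (simp_all add: algebra_simps const_mult_add const_mult_right)

lemma ideal_cong_const_mult: "ideal_cong R x y \<Longrightarrow> ideal_cong R (const_mult c x) (const_mult c y)"
  unfolding const_mult_def by (rule ideal_cong_mult[OF ideal_cong_refl])

definition mon_ext ::
    "(complex \<Rightarrow> complex) \<Rightarrow> ('m::monoid_add \<Rightarrow> 'b::complex_algebra) \<Rightarrow> ('m \<Rightarrow>\<^sub>0 complex) \<Rightarrow> 'b"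
  where "mon_ext \<sigma> h p = (\<Sum>m\<in>Poly_Mapping.keys p. \<sigma> (Poly_Mapping.lookup p m) *\<^sub>C h m)"

definition field_endo :: "(complex \<Rightarrow> complex) \<Rightarrow> bool" where
  "field_endo \<sigma> \<longleftrightarrow> (\<forall>c d. \<sigma> (c + d) = \<sigma> c + \<sigma> d) \<and> (\<forall>c d. \<sigma> (c * d) = \<sigma> c * \<sigma> d) \<and> \<sigma> 1 = 1"

lemma field_endo_id: "field_endo id" and field_endo_cnj: "field_endo cnj"
  by (simp_all add: field_endo_def)

lemma field_endo_zero: "field_endo \<sigma> \<Longrightarrow> \<sigma> 0 = 0"
  unfolding field_endo_def by (metis add_cancel_left_left)

lemma mon_ext_single:
  "field_endo \<sigma> \<Longrightarrow> mon_ext \<sigma> h (Poly_Mapping.single m c) = \<sigma> c *\<^sub>C h m"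
  by (auto simp: mon_ext_def field_endo_zero)

lemma mon_ext_zero: "mon_ext \<sigma> h 0 = 0"
  by (simp add: mon_ext_def)

lemma mon_ext_add:
  assumes "field_endo \<sigma>"
  shows "mon_ext \<sigma> h (p + q) = mon_ext \<sigma> h p + mon_ext \<sigma> h q"
  unfolding mon_ext_def
  by (rule setsum_keys_plus_distrib)
    (use assms in \<open>auto simp: field_endo_zero field_endo_def scaleC_add_left\<close>)

lemma mon_ext_uminus: "field_endo \<sigma> \<Longrightarrow> mon_ext \<sigma> h (- p) = - mon_ext \<sigma> h p"
  using mon_ext_add[of \<sigma> h p "- p"] by (simp add: mon_ext_zero eq_neg_iff_add_eq_0 add.commute)

lemma mon_ext_diff: "field_endo \<sigma> \<Longrightarrow> mon_ext \<sigma> h (p - q) = mon_ext \<sigma> h p - mon_ext \<sigma> h q"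
  using mon_ext_add[of \<sigma> h p "- q"] by (simp add: mon_ext_uminus)

lemma mon_ext_const_mult:
  "field_endo \<sigma> \<Longrightarrow> mon_ext \<sigma> h (const_mult c p) = \<sigma> c *\<^sub>C mon_ext \<sigma> h p"
  by (induction p rule: monoid_algebra_induct)
    (auto simp: const_mult_single mon_ext_single mon_ext_add const_mult_add scaleC_scaleC
      scaleC_add_right field_endo_def, auto simp: const_mult_def mon_ext_zero)

lemma mon_ext_mult:
  assumes "field_endo \<sigma>" "\<And>m n. h (m + n) = h m * h n"
  shows "mon_ext \<sigma> h (p * q) = mon_ext \<sigma> h p * mon_ext \<sigma> h q"
proof (induction p rule: monoid_algebra_induct)
  case (single m c)
  show ?case
    by (induction q rule: monoid_algebra_induct)
      (use assms in \<open>auto simp: mult_single mon_ext_zero mon_ext_single mon_ext_add distrib_left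
        scaleC_add_right scaleC_mult_left scaleC_mult_right scaleC_scaleC field_endo_def mult.commute\<close>)
qed (use assms(1) in \<open>auto simp: mon_ext_zero mon_ext_add distrib_right\<close>)

lemma mon_ext_antimult:
  assumes "field_endo \<sigma>" "\<And>m n. h (m + n) = h n * h m"
  shows "mon_ext \<sigma> h (p * q) = mon_ext \<sigma> h q * mon_ext \<sigma> h p"
proof (induction p rule: monoid_algebra_induct)
  case (single m c)
  show ?case
    by (induction q rule: monoid_algebra_induct)
      (use assms in \<open>auto simp: mult_single mon_ext_zero mon_ext_single mon_ext_add distrib_left
        distrib_right scaleC_add_right scaleC_mult_left scaleC_mult_right scaleC_scaleC field_endo_def mult.commute\<close>)
qed (use assms(1) in \<open>auto simp: mon_ext_zero mon_ext_add distrib_left distrib_right\<close>)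

lemma mon_ext_ideal_cong:
  assumes \<sigma>: "field_endo \<sigma>"
    and mult: "(\<forall>p q. mon_ext \<sigma> h (p * q) = mon_ext \<sigma> h p * mon_ext \<sigma> h q) \<or>
      (\<forall>p q. mon_ext \<sigma> h (p * q) = mon_ext \<sigma> h q * mon_ext \<sigma> h p)"
    and R: "\<And>r. r \<in> R \<Longrightarrow> mon_ext \<sigma> h r = 0"
    and xy: "ideal_cong R x y"
  shows "mon_ext \<sigma> h x = mon_ext \<sigma> h y"
proof -
  have "mon_ext \<sigma> h z = 0" if "z \<in> two_sided_ideal R" for z
    using that
  proof induction
    case (gen r)
    then show ?case by (rule R)
  next
    case zero
    show ?case by (rule mon_ext_zero)
  next
    case (add x y)
    then show ?case using \<sigma> by (simp add: mon_ext_add)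
  next
    case (mult_left x a)
    then show ?case using mult by (metis mult_zero_left mult_zero_right)
  next
    case (mult_right x a)
    then show ?case using mult by (metis mult_zero_left mult_zero_right)
  qed
  from this[OF xy[unfolded ideal_cong_def]] show ?thesis
    using \<sigma> by (simp add: mon_ext_diff)
qed

section \<open>Tensor products of algebras\<close>

text \<open>
  \<open>'a \<times> 'b\<close> as a multiplicative monoid. Its monoid algebra is the free vector space on
  \<open>'a \<times> 'b\<close> with the product \<open>(a, b) (a', b') = (a a', b b')\<close>. The linear span of the bilinearity
  relations below is stable under multiplication by pairs, hence is the ideal they generate, and
  the quotient is the tensor product with its usual algebra structure.
\<close>

datatype ('a, 'b) tpair = TPair 'a 'b

instantiation tpair :: (monoid_mult, monoid_mult) monoid_add
begin
definition zero_tpair :: "('a, 'b) tpair" where "zero_tpair = TPair 1 1"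
fun plus_tpair :: "('a, 'b) tpair \<Rightarrow> ('a, 'b) tpair \<Rightarrow> ('a, 'b) tpair" where
  "plus_tpair (TPair a b) (TPair a' b') = TPair (a * a') (b * b')"
instance
proof
  fix x y z :: "('a, 'b) tpair"
  show "x + y + z = x + (y + z)"
    by (cases x; cases y; cases z) (simp add: mult.assoc)
  show "0 + x = x" "x + 0 = x"
    by (cases x; simp add: zero_tpair_def)+
qed
end

abbreviation (input) pure :: "'a \<Rightarrow> 'b \<Rightarrow> ('a::monoid_mult, 'b::monoid_mult) tpair \<Rightarrow>\<^sub>0 complex"
  where "pure a b \<equiv> Poly_Mapping.single (TPair a b) 1"

definition bilinearity_relations ::
    "(('a::complex_algebra, 'b::complex_algebra) tpair \<Rightarrow>\<^sub>0 complex) set" where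
  "bilinearity_relations =
     {pure (a + a') b - pure a b - pure a' b | a a' b. True} \<union>
     {pure a (b + b') - pure a b - pure a b' | a b b'. True} \<union>
     {pure (c *\<^sub>C a) b - const_mult c (pure a b) | c a b. True} \<union>
     {pure a (c *\<^sub>C b) - const_mult c (pure a b) | c a b. True}"

quotient_type (overloaded) ('a, 'b) tensor =
    "('a::complex_algebra, 'b::complex_algebra) tpair \<Rightarrow>\<^sub>0 complex" /
    "ideal_cong bilinearity_relations"
  by (rule equivp_ideal_cong)

instantiation tensor :: (complex_algebra, complex_algebra) complex_algebra
begin
lift_definition zero_tensor :: "('a, 'b) tensor" is 0 .
lift_definition one_tensor :: "('a, 'b) tensor" is 1 .
lift_definition plus_tensor :: "('a, 'b) tensor \<Rightarrow> ('a, 'b) tensor \<Rightarrow> ('a, 'b) tensor" is "(+)"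
  by (rule ideal_cong_add)
lift_definition minus_tensor :: "('a, 'b) tensor \<Rightarrow> ('a, 'b) tensor \<Rightarrow> ('a, 'b) tensor" is "(-)"
  by (rule ideal_cong_diff)
lift_definition uminus_tensor :: "('a, 'b) tensor \<Rightarrow> ('a, 'b) tensor" is uminus
  by (rule ideal_cong_uminus)
lift_definition times_tensor :: "('a, 'b) tensor \<Rightarrow> ('a, 'b) tensor \<Rightarrow> ('a, 'b) tensor" is "(*)"
  by (rule ideal_cong_mult)
lift_definition scaleC_tensor :: "complex \<Rightarrow> ('a, 'b) tensor \<Rightarrow> ('a, 'b) tensor" is const_mult
  by (rule ideal_cong_const_mult)
instance
  by standard (transfer, rule ideal_cong_eqI, fact monoid_algebra_laws)+
end

lift_definition tensor_pure :: "'a \<Rightarrow> 'b \<Rightarrow> ('a::complex_algebra, 'b::complex_algebra) tensor"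
  (infixr "\<otimes>" 72) is "\<lambda>a b. pure a b" .

lemma tensor_add_left: "(a + a') \<otimes> b = a \<otimes> b + a' \<otimes> b"
  and tensor_add_right: "a \<otimes> (b + b') = a \<otimes> b + a \<otimes> b'"
  and tensor_scale_left: "(c *\<^sub>C a) \<otimes> b = c *\<^sub>C (a \<otimes> b)"
  and tensor_scale_right: "a \<otimes> (c *\<^sub>C b) = c *\<^sub>C (a \<otimes> b)"
  by (transfer, unfold ideal_cong_def diff_diff_eq[symmetric], rule two_sided_ideal.gen,
      unfold bilinearity_relations_def, blast)+

lemma tensor_mult: "(a \<otimes> b) * (a' \<otimes> b') = (a * a') \<otimes> (b * b')"
  by (transfer, rule ideal_cong_eqI) (simp add: mult_single)

lemma tensor_one: "(1::('a::complex_algebra, 'b::complex_algebra) tensor) = 1 \<otimes> 1"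
  by (transfer, rule ideal_cong_eqI) (simp add: zero_tpair_def flip: single_one)

lemma tensor_induct [case_names zero pure scale add]:
  fixes x :: "('a::complex_algebra, 'b::complex_algebra) tensor"
  assumes "P 0" "\<And>a b. P (a \<otimes> b)" "\<And>c x. P x \<Longrightarrow> P (c *\<^sub>C x)"
    "\<And>x y. P x \<Longrightarrow> P y \<Longrightarrow> P (x + y)"
  shows "P x"
proof -
  have "P (abs_tensor p)" for p :: "('a, 'b) tpair \<Rightarrow>\<^sub>0 complex"
  proof (induction p rule: monoid_algebra_induct)
    case zero
    show ?case using assms(1) by (simp add: zero_tensor_def)
  next
    case (single m c)
    obtain a b where m: "m = TPair a b" by (cases m)
    have "abs_tensor (Poly_Mapping.single m c) = c *\<^sub>C (a \<otimes> b)"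
      by (simp add: m tensor_pure.abs_eq scaleC_tensor.abs_eq const_mult_single)
    then show ?case using assms(2,3) by simp
  next
    case (add p q)
    then show ?case using assms(4)[of "abs_tensor p" "abs_tensor q"] by (simp add: plus_tensor.abs_eq)
  qed
  then show ?thesis by (metis Quotient_tensor Quotient_abs_rep)
qed

text \<open>
  The map \<open>f \<otimes> g\<close> for \<open>f\<close>, \<open>g\<close> that are both linear (\<open>\<sigma> = id\<close>) or both antilinear (\<open>\<sigma> = cnj\<close>).
\<close>

definition is_tensor_map :: "(complex \<Rightarrow> complex) \<Rightarrow>
    ('a::complex_algebra \<Rightarrow> 'c::complex_algebra) \<Rightarrow> ('b::complex_algebra \<Rightarrow> 'd::complex_algebra) \<Rightarrow>
    (('a, 'b) tensor \<Rightarrow> ('c, 'd) tensor) \<Rightarrow> bool" where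
  "is_tensor_map \<sigma> f g T \<longleftrightarrow> semilinear \<sigma> T \<and> (\<forall>a b. T (a \<otimes> b) = f a \<otimes> g b)"

definition tensor_map :: "(complex \<Rightarrow> complex) \<Rightarrow>
    ('a::complex_algebra \<Rightarrow> 'c::complex_algebra) \<Rightarrow> ('b::complex_algebra \<Rightarrow> 'd::complex_algebra) \<Rightarrow>
    ('a, 'b) tensor \<Rightarrow> ('c, 'd) tensor" where
  "tensor_map \<sigma> f g = (THE T. is_tensor_map \<sigma> f g T)"

lemma ex1_tensor_map:
  fixes f :: "'a::complex_algebra \<Rightarrow> 'c::complex_algebra"
    and g :: "'b::complex_algebra \<Rightarrow> 'd::complex_algebra"
  assumes \<sigma>: "field_endo \<sigma>" and f: "semilinear \<sigma> f" and g: "semilinear \<sigma> g"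
  shows "\<exists>!T. is_tensor_map \<sigma> f g T"
proof (rule ex_ex1I)
  define h where "h = (\<lambda>m. case m of TPair a b \<Rightarrow> f a \<otimes> g b)"
  have single: "mon_ext \<sigma> h (Poly_Mapping.single (TPair a b) 1) = f a \<otimes> g b" for a b
    using \<sigma> by (simp add: mon_ext_single h_def) (simp add: field_endo_def)
  have span: "mon_ext \<sigma> h z = 0"
    if "z \<in> two_sided_ideal bilinearity_relations" for z
  proof -
    have rel0: "mon_ext \<sigma> h (p * (r * q)) = 0"
      if r: "r \<in> bilinearity_relations" for r p q
    proof (induction p rule: monoid_algebra_induct)
      case (single m c)
      show ?case
      proof (induction q rule: monoid_algebra_induct)
        case (single n d)
        obtain u v where m: "m = TPair u v" by (cases m)
        obtain u' v' where n: "n = TPair u' v'" by (cases n)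
        have sc: "\<sigma> (x * y) = \<sigma> x * \<sigma> y" "\<sigma> 1 = 1" for x y
          using \<sigma> by (auto simp: field_endo_def)
        show ?case
          using r f g unfolding bilinearity_relations_def
          by (auto simp: m n h_def left_diff_distrib right_diff_distrib mult_single
              const_mult_single mon_ext_diff[OF \<sigma>] mon_ext_single[OF \<sigma>] semilinear_def sc
              distrib_left distrib_right tensor_add_left tensor_add_right scaleC_add_right
              scaleC_mult_left scaleC_mult_right tensor_scale_left tensor_scale_right
              scaleC_scaleC mult_ac)
      qed (auto simp: mon_ext_zero mon_ext_add[OF \<sigma>] distrib_left)
    qed (auto simp: mon_ext_zero mon_ext_add[OF \<sigma>] distrib_right)
    have "mon_ext \<sigma> h (p * (z * q)) = 0" for p q
      using that
    proof (induction arbitrary: p q)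
      case (mult_left x a)
      show ?case using mult_left.IH[of "p * a" q] by (simp add: mult.assoc)
    next
      case (mult_right x a)
      then show ?case by (simp add: mult.assoc)
    qed (auto simp: rel0 mon_ext_zero mon_ext_add[OF \<sigma>] distrib_left distrib_right)
    from this[of 1 1] show ?thesis by simp
  qed
  have resp: "mon_ext \<sigma> h x = mon_ext \<sigma> h y" if "ideal_cong bilinearity_relations x y" for x y
    using span[of "x - y"] that by (simp add: ideal_cong_def mon_ext_diff[OF \<sigma>])
  define T where "T x = mon_ext \<sigma> h (rep_tensor x)" for x
  have T: "T (abs_tensor p) = mon_ext \<sigma> h p" for p
    unfolding T_def by (rule resp) (metis Quotient3_rep_abs Quotient3_tensor ideal_cong_refl)
  have abs: "\<exists>p. x = abs_tensor p" for x :: "('a, 'b) tensor"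
    by (metis Quotient_tensor Quotient_abs_rep)
  have "is_tensor_map \<sigma> f g T"
    unfolding is_tensor_map_def semilinear_def
  proof (intro conjI allI)
    fix x y :: "('a, 'b) tensor" and c
    obtain p q where "x = abs_tensor p" "y = abs_tensor q" using abs by metis
    then show "T (x + y) = T x + T y" "T (c *\<^sub>C x) = \<sigma> c *\<^sub>C T x"
      by (simp_all add: plus_tensor.abs_eq scaleC_tensor.abs_eq T mon_ext_add[OF \<sigma>]
          mon_ext_const_mult[OF \<sigma>])
  next
    fix a b
    show "T (a \<otimes> b) = f a \<otimes> g b"
      by (simp add: tensor_pure.abs_eq T single)
  qed
  then show "\<exists>T. is_tensor_map \<sigma> f g T" by blast
next
  fix T T'
  assume T: "is_tensor_map \<sigma> f g T" "is_tensor_map \<sigma> f g T'"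
  have "T x = T' x" for x
  proof (induction x rule: tensor_induct)
    case zero
    show ?case using T unfolding is_tensor_map_def semilinear_def
      by (metis add_cancel_left_left)
  qed (use T in \<open>auto simp: is_tensor_map_def semilinear_def\<close>)
  then show "T = T'" ..
qed

lemma tensor_map_pure:
  assumes "field_endo \<sigma>" "semilinear \<sigma> f" "semilinear \<sigma> g"
  shows "semilinear \<sigma> (tensor_map \<sigma> f g)" "tensor_map \<sigma> f g (a \<otimes> b) = f a \<otimes> g b"
  using theI'[OF ex1_tensor_map[OF assms]] by (auto simp: tensor_map_def is_tensor_map_def)

section \<open>The algebra\<close>

datatype gen = GK | GE | GF

datatype word = Word "gen list"

instantiation word :: monoid_add
begin
definition zero_word :: word where "zero_word = Word []"
fun plus_word :: "word \<Rightarrow> word \<Rightarrow> word" where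
  "plus_word (Word u) (Word v) = Word (u @ v)"
instance
proof
  fix x y z :: word
  show "x + y + z = x + (y + z)"
    by (cases x; cases y; cases z) simp
  show "0 + x = x" "x + 0 = x"
    by (cases x; simp add: zero_word_def)+
qed
end

text \<open>\<open>word \<Rightarrow>\<^sub>0 complex\<close> is the free algebra on \<open>K\<close>, \<open>E\<close>, \<open>F\<close>.\<close>

abbreviation (input) var :: "gen \<Rightarrow> word \<Rightarrow>\<^sub>0 complex"
  where "var g \<equiv> Poly_Mapping.single (Word [g]) 1"

definition H1i_relations :: "(word \<Rightarrow>\<^sub>0 complex) set" where
  "H1i_relations =
     {var GK * var GE + var GE * var GK,
      var GK * var GF + var GF * var GK,
      var GE * var GF - var GF * var GE,
      var GE * var GE,
      var GF * var GF,
      var GK * var GK - 1}"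

quotient_type H1i = "word \<Rightarrow>\<^sub>0 complex" / "ideal_cong H1i_relations"
  by (rule equivp_ideal_cong)

instantiation H1i :: complex_algebra
begin
lift_definition zero_H1i :: H1i is 0 .
lift_definition one_H1i :: H1i is 1 .
lift_definition plus_H1i :: "H1i \<Rightarrow> H1i \<Rightarrow> H1i" is "(+)" by (rule ideal_cong_add)
lift_definition minus_H1i :: "H1i \<Rightarrow> H1i \<Rightarrow> H1i" is "(-)" by (rule ideal_cong_diff)
lift_definition uminus_H1i :: "H1i \<Rightarrow> H1i" is uminus by (rule ideal_cong_uminus)
lift_definition times_H1i :: "H1i \<Rightarrow> H1i \<Rightarrow> H1i" is "(*)" by (rule ideal_cong_mult)
lift_definition scaleC_H1i :: "complex \<Rightarrow> H1i \<Rightarrow> H1i" is const_mult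
  by (rule ideal_cong_const_mult)
instance
  by standard (transfer, rule ideal_cong_eqI, fact monoid_algebra_laws)+
end

lift_definition K :: H1i is "var GK" .
lift_definition E :: H1i is "var GE" .
lift_definition F :: H1i is "var GF" .

definition H1i_rels :: "'a::complex_algebra \<Rightarrow> 'a \<Rightarrow> 'a \<Rightarrow> bool" where
  "H1i_rels k e f \<longleftrightarrow> k * e = - (e * k) \<and> k * f = - (f * k) \<and> e * f = f * e \<and>
     e * e = 0 \<and> f * f = 0 \<and> k * k = 1"

lemma H1i_rels_KEF: "H1i_rels K E F"
proof -
  have "K * E + E * K = 0" "K * F + F * K = 0" "E * F - F * E = 0" "E * E = 0" "F * F = 0"
    "K * K - 1 = 0"
    by (transfer, simp only: ideal_cong_def diff_zero, rule two_sided_ideal.gen,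
        unfold H1i_relations_def, blast)+
  then show ?thesis
    by (simp add: H1i_rels_def eq_neg_iff_add_eq_0)
qed

lemma H1i_induct [case_names one K E F scale add]:
  assumes "P 1" "\<And>x. P x \<Longrightarrow> P (K * x)" "\<And>x. P x \<Longrightarrow> P (E * x)" "\<And>x. P x \<Longrightarrow> P (F * x)"
    "\<And>c x. P x \<Longrightarrow> P (c *\<^sub>C x)" "\<And>x y. P x \<Longrightarrow> P y \<Longrightarrow> P (x + y)"
  shows "P x"
proof -
  have word: "P (abs_H1i (Poly_Mapping.single (Word w) 1))" for w
  proof (induction w)
    case Nil
    have "Poly_Mapping.single (Word []) 1 = (1 :: word \<Rightarrow>\<^sub>0 complex)"
      by (simp flip: zero_word_def)
    then show ?case using assms(1) by (simp add: one_H1i_def)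
  next
    case (Cons g w)
    have "abs_H1i (Poly_Mapping.single (Word (g # w)) 1) =
        (case g of GK \<Rightarrow> K | GE \<Rightarrow> E | GF \<Rightarrow> F) * abs_H1i (Poly_Mapping.single (Word w) 1)"
      by (cases g) (simp_all add: K.abs_eq E.abs_eq F.abs_eq times_H1i.abs_eq mult_single)
    then show ?case using assms(2-4) Cons by (cases g) simp_all
  qed
  have *: "P (abs_H1i (Poly_Mapping.single m c))" for m c
  proof (cases m)
    case (Word w)
    have "abs_H1i (Poly_Mapping.single m c) = c *\<^sub>C abs_H1i (Poly_Mapping.single (Word w) 1)"
      by (simp add: Word scaleC_H1i.abs_eq const_mult_single)
    then show ?thesis using assms(5) word by simp
  qed
  have "P (abs_H1i p)" for p
  proof (induction p rule: monoid_algebra_induct)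
    case zero
    show ?case using *[of 0 0] by (simp add: zero_H1i_def)
  next
    case (single m c)
    show ?case by (rule *)
  next
    case (add p q)
    then show ?case using assms(6)[of "abs_H1i p" "abs_H1i q"] by (simp add: plus_H1i.abs_eq)
  qed
  then show ?thesis by (metis Quotient_H1i Quotient_abs_rep)
qed

lemma H1i_extension:
  fixes k e f :: "'a::complex_algebra"
  assumes \<sigma>: "field_endo \<sigma>" and rels: "H1i_rels k e f"
  shows "\<exists>T. semilinear \<sigma> T \<and> (\<forall>x y. T (x * y) = (if anti then T y * T x else T x * T y)) \<and>
    T 1 = 1 \<and> T K = k \<and> T E = e \<and> T F = f"
proof -
  define v where "v = (\<lambda>g. case g of GK \<Rightarrow> k | GE \<Rightarrow> e | GF \<Rightarrow> f)"
  define h where "h = (\<lambda>m. case m of Word w \<Rightarrow> prod_list (map v (if anti then rev w else w)))"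
  have hadd: "h (m + n) = (if anti then h n * h m else h m * h n)" for m n
    by (cases m; cases n) (simp add: h_def)
  have \<sigma>1: "\<sigma> 1 = 1" using \<sigma> by (simp add: field_endo_def)
  have var: "mon_ext \<sigma> h (Poly_Mapping.single (Word [g]) 1) = v g" for g
    by (simp add: mon_ext_single[OF \<sigma>] \<sigma>1 h_def)
  have one: "mon_ext \<sigma> h 1 = 1"
  proof -
    have "(1 :: word \<Rightarrow>\<^sub>0 complex) = Poly_Mapping.single (Word []) 1"
      by (simp flip: zero_word_def)
    moreover have "mon_ext \<sigma> h (Poly_Mapping.single (Word []) 1) = 1"
      by (simp add: mon_ext_single[OF \<sigma>] \<sigma>1 h_def)
    ultimately show ?thesis by simp
  qed
  have mult: "mon_ext \<sigma> h (p * q) =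
      (if anti then mon_ext \<sigma> h q * mon_ext \<sigma> h p else mon_ext \<sigma> h p * mon_ext \<sigma> h q)" for p q
    using mon_ext_mult[OF \<sigma>, of h p q] mon_ext_antimult[OF \<sigma>, of h p q] hadd by (cases anti) auto
  have rel0: "mon_ext \<sigma> h r = 0" if "r \<in> H1i_relations" for r
    using that rels unfolding H1i_relations_def H1i_rels_def
    by (auto simp: mon_ext_add[OF \<sigma>] mon_ext_diff[OF \<sigma>] mult var one v_def simp del: mult_single)
  have resp: "mon_ext \<sigma> h x = mon_ext \<sigma> h y" if "ideal_cong H1i_relations x y" for x y
    by (rule mon_ext_ideal_cong[OF \<sigma> _ rel0 that]) (use mult in \<open>cases anti; simp\<close>)
  define T where "T x = mon_ext \<sigma> h (rep_H1i x)" for x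
  have T: "T (abs_H1i p) = mon_ext \<sigma> h p" for p
    unfolding T_def by (rule resp) (metis Quotient3_rep_abs Quotient3_H1i ideal_cong_refl)
  have abs: "\<exists>p. x = abs_H1i p" for x
    by (metis Quotient_H1i Quotient_abs_rep)
  have "semilinear \<sigma> T"
    unfolding semilinear_def
  proof (intro conjI allI)
    fix x y c
    obtain p q where "x = abs_H1i p" "y = abs_H1i q" using abs by metis
    then show "T (x + y) = T x + T y" "T (c *\<^sub>C x) = \<sigma> c *\<^sub>C T x"
      by (simp_all add: plus_H1i.abs_eq scaleC_H1i.abs_eq T mon_ext_add[OF \<sigma>]
          mon_ext_const_mult[OF \<sigma>])
  qed
  moreover have "T (x * y) = (if anti then T y * T x else T x * T y)" for x y
    using abs[of x] abs[of y] by (auto simp: times_H1i.abs_eq T mult)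
  moreover have "T 1 = 1" "T K = k" "T E = e" "T F = f"
    by (simp_all add: one_H1i_def K.abs_eq E.abs_eq F.abs_eq T one var v_def)
  ultimately show ?thesis by blast
qed

lemma H1i_hom_eqI:
  assumes "semilinear \<sigma> T" "semilinear \<sigma> T'" "T 1 = T' 1" "T K = T' K" "T E = T' E" "T F = T' F"
    and "\<And>x y. T (x * y) = (if anti then T y * T x else T x * T y)"
    and "\<And>x y. T' (x * y) = (if anti then T' y * T' x else T' x * T' y)"
  shows "T = T'"
proof
  fix x
  show "T x = T' x"
    by (induction x rule: H1i_induct) (use assms in \<open>auto simp: semilinear_def\<close>)
qed

lemma ex1_H1i_hom:
  assumes "H1i_rels k e f"
  shows "\<exists>!T. algebra_hom T \<and> T K = k \<and> T E = e \<and> T F = f"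
proof (rule ex_ex1I)
  show "\<exists>T. algebra_hom T \<and> T K = k \<and> T E = e \<and> T F = f"
    using H1i_extension[OF field_endo_id assms, of False] by (auto simp: algebra_hom_def)
next
  fix T T'
  assume "algebra_hom T \<and> T K = k \<and> T E = e \<and> T F = f"
    "algebra_hom T' \<and> T' K = k \<and> T' E = e \<and> T' F = f"
  then show "T = T'"
    by (intro H1i_hom_eqI[of id T T' False]) (auto simp: algebra_hom_def)
qed

lemma ex1_H1i_antihom:
  assumes "H1i_rels k e f"
  shows "\<exists>!T. algebra_antihom T \<and> T K = k \<and> T E = e \<and> T F = f"
proof (rule ex_ex1I)
  show "\<exists>T. algebra_antihom T \<and> T K = k \<and> T E = e \<and> T F = f"
    using H1i_extension[OF field_endo_id assms, of True]
    by (auto simp: algebra_antihom_def antimultiplicative_def)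
next
  fix T T'
  assume "algebra_antihom T \<and> T K = k \<and> T E = e \<and> T F = f"
    "algebra_antihom T' \<and> T' K = k \<and> T' E = e \<and> T' F = f"
  then show "T = T'"
    by (intro H1i_hom_eqI[of id T T' True])
      (auto simp: algebra_antihom_def antimultiplicative_def)
qed

abbreviation (input) Kinv :: H1i  \<comment> \<open>\<open>K\<close> is its own inverse, since \<open>K\<^sup>2 = 1\<close>\<close>
  where "Kinv \<equiv> K"

definition comult :: "H1i \<Rightarrow> (H1i, H1i) tensor" where
  "comult = (THE D. algebra_hom D \<and> D K = K \<otimes> K \<and> D E = E \<otimes> 1 + K \<otimes> E \<and>
     D F = F \<otimes> Kinv + 1 \<otimes> F)"

definition counit :: "H1i \<Rightarrow> complex" where
  "counit = (THE e. algebra_hom e \<and> e K = 1 \<and> e E = 0 \<and> e F = 0)"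

definition antipode :: "H1i \<Rightarrow> H1i" where
  "antipode = (THE S. algebra_antihom S \<and> S K = Kinv \<and> S E = - (Kinv * E) \<and> S F = - (F * K))"

definition I_op :: "H1i \<Rightarrow> H1i" where
  "I_op = (THE \<Gamma>. star_op \<Gamma> \<and> \<Gamma> K = K \<and> \<Gamma> E = E \<and> \<Gamma> F = F)"

lemma H1i_mult_simps:
  "K * K = 1" "E * E = 0" "F * F = 0" "E * K = - (K * E)" "F * K = - (K * F)" "F * E = E * F"
  "K * (K * x) = x" "E * (E * x) = 0" "F * (F * x) = 0" "E * (K * x) = - (K * (E * x))"
  "F * (K * x) = - (K * (F * x))" "F * (E * x) = E * (F * x)"
proof -
  show *: "K * K = 1" "E * E = 0" "F * F = 0" "E * K = - (K * E)" "F * K = - (K * F)"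
    "F * E = E * F"
    using H1i_rels_KEF unfolding H1i_rels_def by (metis minus_minus)+
  show "K * (K * x) = x" "E * (E * x) = 0" "F * (F * x) = 0" "E * (K * x) = - (K * (E * x))"
    "F * (K * x) = - (K * (F * x))" "F * (E * x) = E * (F * x)"
    unfolding mult.assoc[symmetric] * by simp_all
qed

lemma comult_spec:
  "algebra_hom comult" "comult K = K \<otimes> K" "comult E = E \<otimes> 1 + K \<otimes> E"
  "comult F = F \<otimes> Kinv + 1 \<otimes> F"
proof -
  have neg: "(- x) \<otimes> y = - (x \<otimes> y)" "x \<otimes> (- y) = - (x \<otimes> y)" "(0::H1i) \<otimes> y = 0" "x \<otimes> (0::H1i) = 0"
    for x y :: H1i
    using tensor_scale_left[of "-1" x y] tensor_scale_right[of x "-1" y]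
      tensor_scale_left[of 0 x y] tensor_scale_right[of x 0 y]
    by (simp_all add: scaleC_minus_left)
  have "H1i_rels (K \<otimes> K) (E \<otimes> 1 + K \<otimes> E) (F \<otimes> Kinv + 1 \<otimes> F)"
    unfolding H1i_rels_def
    by (simp add: distrib_left distrib_right tensor_mult tensor_one H1i_mult_simps neg algebra_simps)
  from theI'[OF ex1_H1i_hom[OF this]]
  show "algebra_hom comult" "comult K = K \<otimes> K" "comult E = E \<otimes> 1 + K \<otimes> E"
    "comult F = F \<otimes> Kinv + 1 \<otimes> F"
    by (auto simp: comult_def)
qed

lemma counit_spec: "algebra_hom counit" "counit K = 1" "counit E = 0" "counit F = 0"
proof -
  have "H1i_rels (1::complex) 0 0" by (simp add: H1i_rels_def)
  from theI'[OF ex1_H1i_hom[OF this]]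
  show "algebra_hom counit" "counit K = 1" "counit E = 0" "counit F = 0"
    by (auto simp: counit_def)
qed

lemma antipode_spec:
  "algebra_antihom antipode" "antipode K = Kinv" "antipode E = - (Kinv * E)"
  "antipode F = - (F * K)"
proof -
  have "H1i_rels Kinv (- (Kinv * E)) (- (F * K))"
    unfolding H1i_rels_def by (simp add: H1i_mult_simps mult.assoc)
  from theI'[OF ex1_H1i_antihom[OF this]]
  show "algebra_antihom antipode" "antipode K = Kinv" "antipode E = - (Kinv * E)"
    "antipode F = - (F * K)"
    by (auto simp: antipode_def)
qed

lemma I_op_spec: "star_op I_op" "I_op K = K" "I_op E = E" "I_op F = F"
proof -
  let ?P = "\<lambda>\<Gamma>. star_op \<Gamma> \<and> \<Gamma> K = K \<and> \<Gamma> E = E \<and> \<Gamma> F = F"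
  have "\<exists>!\<Gamma>. ?P \<Gamma>"
  proof (rule ex_ex1I)
    obtain T where T: "semilinear cnj T" "\<And>x y. T (x * y) = T y * T x" "T 1 = 1" "T K = K"
      "T E = E" "T F = F"
      using H1i_extension[OF field_endo_cnj H1i_rels_KEF, of True] by auto
    have "T \<circ> T = id"
      by (rule H1i_hom_eqI[of id _ _ False]) (use T in \<open>auto simp: semilinear_def\<close>)
    then have "?P T"
      using T by (auto simp: star_op_def antimultiplicative_def fun_eq_iff)
    then show "\<exists>\<Gamma>. ?P \<Gamma>" by blast
  next
    fix T T'
    assume T: "?P T" "?P T'"
    have one: "R 1 = 1" if "?P R" for R
    proof -
      have "R (1 * R 1) = R (R 1) * R 1" "R (R 1) = 1"
        using that unfolding star_op_def antimultiplicative_def by blast+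
      then show ?thesis by simp
    qed
    show "T = T'"
      by (rule H1i_hom_eqI[of cnj T T' True])
        (use T one[of T] one[of T'] in \<open>auto simp: star_op_def antimultiplicative_def\<close>)
  qed
  from theI'[OF this] show "star_op I_op" "I_op K = K" "I_op E = E" "I_op F = F"
    by (auto simp: I_op_def)
qed

definition e0 :: H1i where "e0 = (1/2) *\<^sub>C (1 + K)"
definition e1 :: H1i where "e1 = (1/2) *\<^sub>C (1 - K)"
definition E0 :: H1i where "E0 = e0 * E"
definition E1 :: H1i where "E1 = e1 * E"
definition F0 :: H1i where "F0 = e0 * F"
definition F1 :: H1i where "F1 = e1 * F"
definition C0 :: H1i where "C0 = e0 * E * F"
definition C1 :: H1i where "C1 = e1 * E * F"

section \<open>Automorphisms and \<open>*\<close>-operations\<close>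

definition AutS :: "(H1i \<Rightarrow> H1i) set" where
  "AutS = {\<phi>. algebra_hom \<phi> \<and> bij \<phi> \<and> \<phi> \<circ> antipode = antipode \<circ> \<phi>}"

definition AutS_I :: "(H1i \<Rightarrow> H1i) set" where
  "AutS_I = {\<phi> \<in> AutS. \<phi> e0 = e0}"

definition AutS_II :: "(H1i \<Rightarrow> H1i) set" where
  "AutS_II = {\<phi> \<in> AutS. \<phi> e0 = e1}"

definition semi_hopf_star :: "(H1i \<Rightarrow> H1i) \<Rightarrow> bool" where
  "semi_hopf_star \<Gamma> \<longleftrightarrow> \<Gamma> \<circ> \<Gamma> = id \<and> (\<exists>\<phi>\<in>AutS. \<Gamma> = I_op \<circ> \<phi>)"

text \<open>\<open>comult_compatible \<Gamma>\<close> is \<open>\<Delta>(\<Gamma>(a)) = (\<Gamma> \<otimes> \<Gamma>)(\<Delta>(a))\<close>, for antilinear \<open>\<Gamma>\<close>.\<close>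

definition comult_compatible :: "(H1i \<Rightarrow> H1i) \<Rightarrow> bool" where
  "comult_compatible \<Gamma> \<longleftrightarrow> (\<forall>a. comult (\<Gamma> a) = tensor_map cnj \<Gamma> \<Gamma> (comult a))"

definition hopf_star :: "(H1i \<Rightarrow> H1i) \<Rightarrow> bool" where
  "hopf_star \<Gamma> \<longleftrightarrow> star_op \<Gamma> \<and> comult_compatible \<Gamma>"

definition hopf_hom :: "(H1i \<Rightarrow> H1i) \<Rightarrow> bool" where
  "hopf_hom \<phi> \<longleftrightarrow> algebra_hom \<phi> \<and> (\<forall>a. comult (\<phi> a) = tensor_map id \<phi> \<phi> (comult a)) \<and>
     (\<forall>a. counit (\<phi> a) = counit a)"

text \<open>
  The action is \<open>\<Gamma> \<mapsto> \<Gamma> \<circ> \<phi>\<close>, as in \<open>I \<circ> \<phi>\<close>; taking \<open>\<phi>\<close> bijective makes the orbits those of a group.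
\<close>

definition right_orbit :: "(H1i \<Rightarrow> H1i) \<Rightarrow> (H1i \<Rightarrow> H1i) set" where
  "right_orbit \<Gamma> = {\<Gamma> \<circ> \<phi> | \<phi>. hopf_hom \<phi> \<and> bij \<phi>}"

section \<open>The two families\<close>

text \<open>The scalar usually written lambda is called \<open>\<mu>\<close>, the letter lambda being reserved.\<close>

definition table_I ::
    "complex \<Rightarrow> complex \<Rightarrow> complex \<Rightarrow> complex \<Rightarrow> complex \<Rightarrow> (H1i \<Rightarrow> H1i) \<Rightarrow> bool" where
  "table_I \<alpha> \<beta> \<gamma> \<delta> \<mu> \<Gamma> \<longleftrightarrow>
     \<Gamma> e0 = e0 \<and> \<Gamma> E0 = \<alpha> *\<^sub>C E1 + \<beta> *\<^sub>C F1 \<and> \<Gamma> F0 = \<gamma> *\<^sub>C E1 + \<delta> *\<^sub>C F1 \<and> \<Gamma> C0 = \<mu> *\<^sub>C C0 \<and>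
     \<Gamma> e1 = e1 \<and> \<Gamma> E1 = \<alpha> *\<^sub>C E0 - \<beta> *\<^sub>C F0 \<and> \<Gamma> F1 = - (\<gamma> *\<^sub>C E0) + \<delta> *\<^sub>C F0 \<and> \<Gamma> C1 = \<mu> *\<^sub>C C1"

definition table_II ::
    "complex \<Rightarrow> complex \<Rightarrow> complex \<Rightarrow> complex \<Rightarrow> complex \<Rightarrow> (H1i \<Rightarrow> H1i) \<Rightarrow> bool" where
  "table_II \<alpha> \<beta> \<gamma> \<delta> \<mu> \<Gamma> \<longleftrightarrow>
     \<Gamma> e0 = e1 \<and> \<Gamma> E0 = \<alpha> *\<^sub>C E0 + \<beta> *\<^sub>C F0 \<and> \<Gamma> F0 = \<gamma> *\<^sub>C E0 + \<delta> *\<^sub>C F0 \<and> \<Gamma> C0 = \<mu> *\<^sub>C C1 \<and>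
     \<Gamma> e1 = e0 \<and> \<Gamma> E1 = - (\<alpha> *\<^sub>C E1) + \<beta> *\<^sub>C F1 \<and> \<Gamma> F1 = \<gamma> *\<^sub>C E1 - \<delta> *\<^sub>C F1 \<and> \<Gamma> C1 = \<mu> *\<^sub>C C0"

text \<open>
  In both families the two signs \<open>\<plusminus>\<close> (here \<open>s\<close> for \<open>\<beta>\<close> and \<open>t\<close> for \<open>\<gamma>\<close>) are independent, and they
  enter the quadratic constraint: \<open>a\<^sup>2 - (\<plusminus>b)(\<plusminus>c) = 1\<close> for type I and \<open>a\<^sup>2 + (\<plusminus>b)(\<plusminus>c) = 1\<close> for
  type II. This is what \<open>\<alpha>\<delta> - \<beta>\<gamma> = e\<^bsup>i(\<phi>+\<psi>)\<^esup>\<close> amounts to. The constraint \<open>a\<^sup>2 - bc = 1\<close> for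
  nonnegative \<open>b\<close>, \<open>c\<close> is the case of equal signs, which leaves out involutions such as
  \<open>\<alpha> = \<delta> = 0\<close>, \<open>\<beta> = -i\<close>, \<open>\<gamma> = i\<close> in type I. In type II, \<open>a = 0\<close> cannot be excluded: \<open>\<alpha> = \<delta> = 0\<close>,
  \<open>\<beta> = \<gamma> = i\<close> also gives an involution.
\<close>

definition coeffs_I :: "real \<Rightarrow> real \<Rightarrow> real \<Rightarrow> real \<Rightarrow> real \<Rightarrow> real \<Rightarrow> real \<Rightarrow>
    complex \<Rightarrow> complex \<Rightarrow> complex \<Rightarrow> complex \<Rightarrow> complex \<Rightarrow> bool" where
  "coeffs_I a b c \<phi> \<psi> s t \<alpha> \<beta> \<gamma> \<delta> \<mu> \<longleftrightarrow>
     0 \<le> a \<and> 0 \<le> b \<and> 0 \<le> c \<and> s \<in> {-1, 1} \<and> t \<in> {-1, 1} \<and>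
     a\<^sup>2 - (s * b) * (t * c) = 1 \<and>
     \<alpha> = a * cis \<phi> \<and> \<beta> = s * b * cis ((\<phi> + \<psi>) / 2) \<and>
     \<gamma> = t * c * cis ((\<phi> + \<psi>) / 2) \<and> \<delta> = a * cis \<psi> \<and>
     \<mu> = \<alpha> * \<delta> - \<beta> * \<gamma>"

definition coeffs_II :: "real \<Rightarrow> real \<Rightarrow> real \<Rightarrow> real \<Rightarrow> real \<Rightarrow> real \<Rightarrow> real \<Rightarrow>
    complex \<Rightarrow> complex \<Rightarrow> complex \<Rightarrow> complex \<Rightarrow> complex \<Rightarrow> bool" where
  "coeffs_II a b c \<phi> \<psi> s t \<alpha> \<beta> \<gamma> \<delta> \<mu> \<longleftrightarrow>
     0 \<le> a \<and> 0 \<le> b \<and> 0 \<le> c \<and> s \<in> {-1, 1} \<and> t \<in> {-1, 1} \<and>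
     a\<^sup>2 + (s * b) * (t * c) = 1 \<and>
     \<alpha> = a * cis \<phi> \<and> \<beta> = s * \<i> * b * cis ((\<phi> + \<psi>) / 2) \<and>
     \<gamma> = t * \<i> * c * cis ((\<phi> + \<psi>) / 2) \<and> \<delta> = a * cis \<psi> \<and>
     \<mu> = - (\<alpha> * \<delta> - \<beta> * \<gamma>)"

text \<open>The tables list values on a basis, so an antilinear map is determined by its table.\<close>

definition stars_I :: "(H1i \<Rightarrow> H1i) set" where
  "stars_I = {\<Gamma>. semilinear cnj \<Gamma> \<and> (\<exists>a b c \<phi> \<psi> s t \<alpha> \<beta> \<gamma> \<delta> \<mu>.
     coeffs_I a b c \<phi> \<psi> s t \<alpha> \<beta> \<gamma> \<delta> \<mu> \<and> table_I \<alpha> \<beta> \<gamma> \<delta> \<mu> \<Gamma>)}"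

definition stars_II :: "(H1i \<Rightarrow> H1i) set" where
  "stars_II = {\<Gamma>. semilinear cnj \<Gamma> \<and> (\<exists>a b c \<phi> \<psi> s t \<alpha> \<beta> \<gamma> \<delta> \<mu>.
     coeffs_II a b c \<phi> \<psi> s t \<alpha> \<beta> \<gamma> \<delta> \<mu> \<and> table_II \<alpha> \<beta> \<gamma> \<delta> \<mu> \<Gamma>)}"

text \<open>
  The four independent parameters of type I for \<open>\<alpha> \<noteq> 0\<close>: \<open>b\<close> and \<open>c\<close> with their signs absorbed, and
  the two phases; then \<open>a = \<surd>(1 + b c)\<close>.
\<close>

definition family_I :: "real \<times> real \<times> real \<times> real \<Rightarrow> H1i \<Rightarrow> H1i" where
  "family_I = (\<lambda>(b, c, \<phi>, \<psi>). THE \<Gamma>. semilinear cnj \<Gamma> \<and>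
     table_I (sqrt (1 + b * c) * cis \<phi>) (b * cis ((\<phi> + \<psi>) / 2))
       (c * cis ((\<phi> + \<psi>) / 2)) (sqrt (1 + b * c) * cis \<psi>) (cis (\<phi> + \<psi>)) \<Gamma>)"

end

theory Submission
  imports Defs
begin

text \<open>
  The square of the antipode is \<open>1\<close> on the span of \<open>e\<^sub>i\<close>, \<open>C\<^sub>i\<close> and \<open>-1\<close> on that of \<open>E\<^sub>i\<close>, \<open>F\<^sub>i\<close>.
  An automorphism commuting with the antipode preserves both spans, and the nontrivial idempotents
  of the first are \<open>e\<^sub>0\<close> and \<open>e\<^sub>1\<close>; this gives the two types. Comparing \<open>\<phi> \<circ> S\<close> with
  \<open>S \<circ> \<phi>\<close> on \<open>E\<close> and \<open>F\<close> then leaves four complex parameters in each type, which involutivity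
  constrains by four equations. Substituting \<open>(\<beta>, \<gamma>) \<mapsto> (-i \<beta>, i \<gamma>)\<close> turns
  the equations of type II into those of type I, and these say that \<open>\<alpha>\<close>, \<open>\<delta>\<close> have the same
  modulus and \<open>\<beta>\<close>, \<open>\<gamma>\<close> are real multiples of a square root of the product of their phases.

  A Hopf \<open>*\<close>-operation \<open>\<Gamma>\<close> sends \<open>K\<close> to a grouplike involution other than \<open>1\<close>, that is, to \<open>K\<close>,
  and \<open>E\<close>, \<open>F\<close> to skew-primitive elements with square \<open>0\<close>, hence is of type I. In type II, \<open>K\<close> is
  sent to \<open>-K\<close>, which is not grouplike.
\<close>

section \<open>Coordinates\<close>

text \<open>A concrete model on eight complex components. In a quotient of the free algebra the
  relations only yield equalities; a homomorphism to this model also shows elements to be different.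
  Its product encodes that \<open>E\<close> and \<open>F\<close> exchange \<open>e0\<close> and
  \<open>e1\<close> when moved past them, so \<open>E0 * e1 = E0\<close> and
  \<open>E0 * F1 = F0 * E1 = C0\<close>.\<close>

datatype coords = Coords (c_e0: complex) (c_e1: complex) (c_E0: complex) (c_E1: complex)
  (c_F0: complex) (c_F1: complex) (c_C0: complex) (c_C1: complex)

instantiation coords :: complex_algebra
begin
definition zero_coords :: coords where "zero_coords = Coords 0 0 0 0 0 0 0 0"
definition one_coords :: coords where "one_coords = Coords 1 1 0 0 0 0 0 0"
definition plus_coords :: "coords \<Rightarrow> coords \<Rightarrow> coords" where
  "x + y = Coords (c_e0 x + c_e0 y) (c_e1 x + c_e1 y) (c_E0 x + c_E0 y) (c_E1 x + c_E1 y)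
     (c_F0 x + c_F0 y) (c_F1 x + c_F1 y) (c_C0 x + c_C0 y) (c_C1 x + c_C1 y)"
definition minus_coords :: "coords \<Rightarrow> coords \<Rightarrow> coords" where
  "x - y = Coords (c_e0 x - c_e0 y) (c_e1 x - c_e1 y) (c_E0 x - c_E0 y) (c_E1 x - c_E1 y)
     (c_F0 x - c_F0 y) (c_F1 x - c_F1 y) (c_C0 x - c_C0 y) (c_C1 x - c_C1 y)"
definition uminus_coords :: "coords \<Rightarrow> coords" where
  "- x = Coords (- c_e0 x) (- c_e1 x) (- c_E0 x) (- c_E1 x)
     (- c_F0 x) (- c_F1 x) (- c_C0 x) (- c_C1 x)"
definition scaleC_coords :: "complex \<Rightarrow> coords \<Rightarrow> coords" where
  "c *\<^sub>C x = Coords (c * c_e0 x) (c * c_e1 x) (c * c_E0 x) (c * c_E1 x)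
     (c * c_F0 x) (c * c_F1 x) (c * c_C0 x) (c * c_C1 x)"
definition times_coords :: "coords \<Rightarrow> coords \<Rightarrow> coords" where
  "x * y = Coords (c_e0 x * c_e0 y) (c_e1 x * c_e1 y)
     (c_e0 x * c_E0 y + c_E0 x * c_e1 y) (c_e1 x * c_E1 y + c_E1 x * c_e0 y)
     (c_e0 x * c_F0 y + c_F0 x * c_e1 y) (c_e1 x * c_F1 y + c_F1 x * c_e0 y)
     (c_e0 x * c_C0 y + c_C0 x * c_e0 y + c_E0 x * c_F1 y + c_F0 x * c_E1 y)
     (c_e1 x * c_C1 y + c_C1 x * c_e1 y + c_E1 x * c_F0 y + c_F1 x * c_E0 y)"

lemmas coords_defs = zero_coords_def one_coords_def plus_coords_def minus_coords_def
  uminus_coords_def scaleC_coords_def times_coords_def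

instance
  by standard (simp_all add: coords_defs algebra_simps)
end

definition coordinates :: "H1i \<Rightarrow> coords" where
  "coordinates = (THE T. algebra_hom T \<and> T K = Coords 1 (-1) 0 0 0 0 0 0 \<and>
     T E = Coords 0 0 1 1 0 0 0 0 \<and> T F = Coords 0 0 0 0 1 1 0 0)"

lemma coordinates_hom: "algebra_hom coordinates"
  and coordinates_gens [simp]: "coordinates K = Coords 1 (-1) 0 0 0 0 0 0"
    "coordinates E = Coords 0 0 1 1 0 0 0 0" "coordinates F = Coords 0 0 0 0 1 1 0 0"
proof -
  have "H1i_rels (Coords 1 (-1) 0 0 0 0 0 0) (Coords 0 0 1 1 0 0 0 0) (Coords 0 0 0 0 1 1 0 0)"
    by (simp add: H1i_rels_def coords_defs)
  from theI'[OF ex1_H1i_hom[OF this]]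
  show "algebra_hom coordinates" "coordinates K = Coords 1 (-1) 0 0 0 0 0 0"
    "coordinates E = Coords 0 0 1 1 0 0 0 0" "coordinates F = Coords 0 0 0 0 1 1 0 0"
    by (auto simp: coordinates_def)
qed

lemma semilinear_add: "semilinear \<sigma> f \<Longrightarrow> f (x + y) = f x + f y"
  and semilinear_scale: "semilinear \<sigma> f \<Longrightarrow> f (c *\<^sub>C x) = \<sigma> c *\<^sub>C f x"
  by (simp_all add: semilinear_def)

lemma semilinear_zero: "semilinear \<sigma> f \<Longrightarrow> f 0 = 0"
  using semilinear_add[of \<sigma> f 0 0] by simp

lemma semilinear_uminus: "semilinear \<sigma> f \<Longrightarrow> f (- x) = - f x"
  using semilinear_add[of \<sigma> f x "- x"]
  by (simp add: semilinear_zero eq_neg_iff_add_eq_0 add.commute)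

lemma semilinear_diff: "semilinear \<sigma> f \<Longrightarrow> f (x - y) = f x - f y"
  using semilinear_add[of \<sigma> f x "- y"] by (simp add: semilinear_uminus)

lemmas semilinear_simps =
  semilinear_add semilinear_scale semilinear_zero semilinear_uminus semilinear_diff

lemma coordinates_simps [simp]:
  "coordinates (x + y) = coordinates x + coordinates y"
  "coordinates (x - y) = coordinates x - coordinates y"
  "coordinates (- x) = - coordinates x" "coordinates 0 = 0" "coordinates 1 = 1"
  "coordinates (c *\<^sub>C x) = c *\<^sub>C coordinates x"
  "coordinates (x * y) = coordinates x * coordinates y"
  using coordinates_hom semilinear_simps[of id coordinates] by (auto simp: algebra_hom_def)

lemma coordinates_basis [simp]:
  "coordinates e0 = Coords 1 0 0 0 0 0 0 0" "coordinates e1 = Coords 0 1 0 0 0 0 0 0"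
  "coordinates E0 = Coords 0 0 1 0 0 0 0 0" "coordinates E1 = Coords 0 0 0 1 0 0 0 0"
  "coordinates F0 = Coords 0 0 0 0 1 0 0 0" "coordinates F1 = Coords 0 0 0 0 0 1 0 0"
  "coordinates C0 = Coords 0 0 0 0 0 0 1 0" "coordinates C1 = Coords 0 0 0 0 0 0 0 1"
  by (simp_all add: e0_def e1_def E0_def E1_def F0_def F1_def C0_def C1_def coords_defs)

definition of_coords :: "coords \<Rightarrow> H1i" where
  "of_coords v = c_e0 v *\<^sub>C e0 + c_e1 v *\<^sub>C e1 + c_E0 v *\<^sub>C E0 + c_E1 v *\<^sub>C E1 +
     c_F0 v *\<^sub>C F0 + c_F1 v *\<^sub>C F1 + c_C0 v *\<^sub>C C0 + c_C1 v *\<^sub>C C1"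

lemma of_coords_add: "of_coords (v + w) = of_coords v + of_coords w"
  and of_coords_scale: "of_coords (c *\<^sub>C v) = c *\<^sub>C of_coords v"
  by (simp_all add: of_coords_def coords_defs scaleC_add_left scaleC_add_right scaleC_scaleC)

lemma gens_mult_basis:
  "K * e0 = e0" "K * e1 = - e1" "K * E0 = E0" "K * E1 = - E1"
  "K * F0 = F0" "K * F1 = - F1" "K * C0 = C0" "K * C1 = - C1"
  "E * e0 = E1" "E * e1 = E0" "E * E0 = 0" "E * E1 = 0"
  "E * F0 = C1" "E * F1 = C0" "E * C0 = 0" "E * C1 = 0"
  "F * e0 = F1" "F * e1 = F0" "F * E0 = C1" "F * E1 = C0"
  "F * F0 = 0" "F * F1 = 0" "F * C0 = 0" "F * C1 = 0"
  by (simp_all add: e0_def e1_def E0_def E1_def F0_def F1_def C0_def C1_def H1i_mult_simps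
      algebra_simps scaleC_add_right scaleC_diff_right scaleC_minus_right scaleC_mult_left
      scaleC_mult_right)

text \<open>The span of the eight elements contains \<open>1\<close> and is stable under left
  multiplication by the generators, where the product matches that of the model; hence it is
  everything. Together with \<open>coordinates_basis\<close> this makes the eight elements a
  basis.\<close>

lemma of_coords_coordinates [simp]: "of_coords (coordinates x) = x"
proof (induction x rule: H1i_induct)
  case one
  have "(1/2) *\<^sub>C (1::H1i) + (1/2) *\<^sub>C 1 = 1"
    by (simp flip: scaleC_add_left)
  then show ?case
    by (simp add: of_coords_def one_coords_def e0_def e1_def scaleC_add_right scaleC_diff_right)
next
  case (K x)
  have "of_coords (coordinates (K * x)) = K * of_coords (coordinates x)"
    by (simp add: of_coords_def times_coords_def distrib_left scaleC_mult_right gens_mult_basis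
        scaleC_minus_left scaleC_minus_right)
  with K show ?case by simp
next
  case (E x)
  have "of_coords (coordinates (E * x)) = E * of_coords (coordinates x)"
    by (simp add: of_coords_def times_coords_def distrib_left scaleC_mult_right gens_mult_basis)
  with E show ?case by simp
next
  case (F x)
  have "of_coords (coordinates (F * x)) = F * of_coords (coordinates x)"
    by (simp add: of_coords_def times_coords_def distrib_left scaleC_mult_right gens_mult_basis)
  with F show ?case by simp
qed (simp_all add: of_coords_add of_coords_scale)

text \<open>From here on, identities and non-identities in the algebra are decided by comparing
  eight complex numbers.\<close>

lemma H1i_eq_iff: "x = y \<longleftrightarrow> coordinates x = coordinates y"
  by (metis of_coords_coordinates)

lemmas H1i_arith = H1i_eq_iff coords_defs

lemma KEF_basis: "1 = e0 + e1" "K = e0 - e1" "E = E0 + E1" "F = F0 + F1"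
  by (simp_all add: H1i_arith)

lemma basis_mult:
  "e0 * e0 = e0" "e0 * e1 = 0" "e1 * e0 = 0" "e1 * e1 = e1" "e0 * K = e0" "e1 * K = - e1"
  "e0 * E = E0" "e1 * E = E1" "e0 * F = F0" "e1 * F = F1"
  "E0 * F = C0" "E1 * F = C1" "E0 * K = - E0" "E1 * K = E1" "F0 * K = - F0" "F1 * K = F1"
  by (simp_all add: H1i_arith)

section \<open>Antilinear involutions\<close>

lemma algebra_homD:
  assumes "algebra_hom f"
  shows "f (x + y) = f x + f y" "f (x - y) = f x - f y" "f (- x) = - f x" "f 0 = 0"
    "f (c *\<^sub>C x) = c *\<^sub>C f x" "f (x * y) = f x * f y" "f 1 = 1"
  using assms semilinear_simps[of id f] by (auto simp: algebra_hom_def)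

text \<open>A \<open>star_op\<close> with involutivity replaced by preservation of \<open>1\<close>.
  Such maps can be prescribed on generators, and involutivity then becomes a condition on
  coefficients.\<close>

definition cnj_antihom :: "('a::complex_algebra \<Rightarrow> 'b::complex_algebra) \<Rightarrow> bool" where
  "cnj_antihom \<Gamma> \<longleftrightarrow> semilinear cnj \<Gamma> \<and> antimultiplicative \<Gamma> \<and> \<Gamma> 1 = 1"

lemma cnj_antihomD:
  assumes "cnj_antihom f"
  shows "f (x + y) = f x + f y" "f (x - y) = f x - f y" "f (- x) = - f x" "f 0 = 0"
    "f (c *\<^sub>C x) = cnj c *\<^sub>C f x" "f (x * y) = f y * f x" "f 1 = 1"
  using assms semilinear_simps[of cnj f] by (auto simp: cnj_antihom_def antimultiplicative_def)

lemma algebra_hom_eqI: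
  assumes "algebra_hom T" "algebra_hom T'" "T K = T' K" "T E = T' E" "T F = T' F"
  shows "T = T'"
  by (rule H1i_hom_eqI[of id T T' False]) (use assms in \<open>auto simp: algebra_hom_def\<close>)

lemma algebra_antihom_eqI:
  assumes "algebra_antihom T" "algebra_antihom T'" "T K = T' K" "T E = T' E" "T F = T' F"
  shows "T = T'"
  by (rule H1i_hom_eqI[of id T T' True])
    (use assms in \<open>auto simp: algebra_antihom_def antimultiplicative_def\<close>)

lemma cnj_antihom_eqI:
  assumes "cnj_antihom T" "cnj_antihom T'" "T K = T' K" "T E = T' E" "T F = T' F"
  shows "T = T'"
  by (rule H1i_hom_eqI[of cnj T T' True])
    (use assms in \<open>auto simp: cnj_antihom_def antimultiplicative_def\<close>)

lemma semilinear_eqI: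
  assumes "semilinear \<sigma> f" "semilinear \<sigma> g" "f e0 = g e0" "f e1 = g e1" "f E0 = g E0"
    "f E1 = g E1" "f F0 = g F0" "f F1 = g F1" "f C0 = g C0" "f C1 = g C1"
  shows "f = g"
proof
  fix x
  have "f (of_coords v) = g (of_coords v)" for v
    by (simp add: of_coords_def semilinear_simps[OF assms(1)] semilinear_simps[OF assms(2)]
        assms(3-))
  from this[of "coordinates x"] show "f x = g x" by simp
qed

lemma algebra_hom_id: "algebra_hom (\<lambda>x. x)"
  by (simp add: algebra_hom_def semilinear_def)

lemma algebra_hom_comp: "algebra_hom f \<Longrightarrow> algebra_hom g \<Longrightarrow> algebra_hom (f \<circ> g)"
  by (simp add: algebra_hom_def semilinear_def)

lemma cnj_antihom_comp: "cnj_antihom f \<Longrightarrow> cnj_antihom g \<Longrightarrow> algebra_hom (f \<circ> g)"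
  by (simp add: algebra_hom_def cnj_antihom_def antimultiplicative_def semilinear_def)

lemma cnj_antihom_comp_hom: "cnj_antihom f \<Longrightarrow> algebra_hom g \<Longrightarrow> cnj_antihom (f \<circ> g)"
  by (simp add: algebra_hom_def cnj_antihom_def antimultiplicative_def semilinear_def)

lemma star_op_iff: "star_op \<Gamma> \<longleftrightarrow> cnj_antihom \<Gamma> \<and> \<Gamma> \<circ> \<Gamma> = id"
proof -
  have "\<Gamma> 1 = 1" if "star_op \<Gamma>"
  proof -
    \<comment> \<open>The left side is \<open>\<Gamma> (\<Gamma> 1) = 1\<close> and the right side
      is \<open>1 * \<Gamma> 1\<close>.\<close>
    have "\<Gamma> (1 * \<Gamma> 1) = \<Gamma> (\<Gamma> 1) * \<Gamma> 1" "\<Gamma> (\<Gamma> 1) = 1"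
      using that unfolding star_op_def antimultiplicative_def by blast+
    then show ?thesis by simp
  qed
  then show ?thesis by (auto simp: star_op_def cnj_antihom_def fun_eq_iff)
qed

text \<open>The defining relations have real coefficients and are stable under reversal of products,
  so the images have to satisfy the same relations as for a homomorphism.\<close>

lemma ex1_cnj_antihom:
  assumes "H1i_rels k e f"
  shows "\<exists>!\<Gamma>. cnj_antihom \<Gamma> \<and> \<Gamma> K = k \<and> \<Gamma> E = e \<and> \<Gamma> F = f"
proof (rule ex_ex1I)
  show "\<exists>\<Gamma>. cnj_antihom \<Gamma> \<and> \<Gamma> K = k \<and> \<Gamma> E = e \<and> \<Gamma> F = f"
    using H1i_extension[OF field_endo_cnj assms, of True]
    by (auto simp: cnj_antihom_def antimultiplicative_def)
qed (auto intro: cnj_antihom_eqI)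

section \<open>The antilinear antihomomorphisms behind the two tables\<close>

definition star_I :: "complex \<Rightarrow> complex \<Rightarrow> complex \<Rightarrow> complex \<Rightarrow> H1i \<Rightarrow> H1i" where
  "star_I \<alpha> \<beta> \<gamma> \<delta> = (THE \<Gamma>. cnj_antihom \<Gamma> \<and> \<Gamma> K = K \<and>
     \<Gamma> E = \<alpha> *\<^sub>C E - \<beta> *\<^sub>C (K * F) \<and> \<Gamma> F = \<delta> *\<^sub>C F - \<gamma> *\<^sub>C (K * E))"

text \<open>In both definitions the images of \<open>E\<close> and \<open>F\<close> are sums of two
  rows of the table, rewritten with \<open>E = E0 + E1\<close>, \<open>F = F0 + F1\<close>,
  \<open>K * E = E0 - E1\<close> and \<open>K * F = F0 - F1\<close>. The coefficients are arbitrary;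
  involutivity is imposed separately.\<close>

definition star_II :: "complex \<Rightarrow> complex \<Rightarrow> complex \<Rightarrow> complex \<Rightarrow> H1i \<Rightarrow> H1i" where
  "star_II \<alpha> \<beta> \<gamma> \<delta> = (THE \<Gamma>. cnj_antihom \<Gamma> \<and> \<Gamma> K = - K \<and>
     \<Gamma> E = \<alpha> *\<^sub>C (K * E) + \<beta> *\<^sub>C F \<and> \<Gamma> F = \<gamma> *\<^sub>C E + \<delta> *\<^sub>C (K * F))"

lemma star_I_antihom: "cnj_antihom (star_I \<alpha> \<beta> \<gamma> \<delta>)"
  and star_I_gens: "star_I \<alpha> \<beta> \<gamma> \<delta> K = K"
    "star_I \<alpha> \<beta> \<gamma> \<delta> E = \<alpha> *\<^sub>C E - \<beta> *\<^sub>C (K * F)"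
    "star_I \<alpha> \<beta> \<gamma> \<delta> F = \<delta> *\<^sub>C F - \<gamma> *\<^sub>C (K * E)"
proof -
  have "H1i_rels K (\<alpha> *\<^sub>C E - \<beta> *\<^sub>C (K * F)) (\<delta> *\<^sub>C F - \<gamma> *\<^sub>C (K * E))"
    by (simp add: H1i_rels_def H1i_arith)
  from theI'[OF ex1_cnj_antihom[OF this]]
  show "cnj_antihom (star_I \<alpha> \<beta> \<gamma> \<delta>)" "star_I \<alpha> \<beta> \<gamma> \<delta> K = K"
    "star_I \<alpha> \<beta> \<gamma> \<delta> E = \<alpha> *\<^sub>C E - \<beta> *\<^sub>C (K * F)"
    "star_I \<alpha> \<beta> \<gamma> \<delta> F = \<delta> *\<^sub>C F - \<gamma> *\<^sub>C (K * E)"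
    by (simp_all add: star_I_def)
qed

lemma star_II_antihom: "cnj_antihom (star_II \<alpha> \<beta> \<gamma> \<delta>)"
  and star_II_gens: "star_II \<alpha> \<beta> \<gamma> \<delta> K = - K"
    "star_II \<alpha> \<beta> \<gamma> \<delta> E = \<alpha> *\<^sub>C (K * E) + \<beta> *\<^sub>C F"
    "star_II \<alpha> \<beta> \<gamma> \<delta> F = \<gamma> *\<^sub>C E + \<delta> *\<^sub>C (K * F)"
proof -
  have "H1i_rels (- K) (\<alpha> *\<^sub>C (K * E) + \<beta> *\<^sub>C F) (\<gamma> *\<^sub>C E + \<delta> *\<^sub>C (K * F))"
    by (simp add: H1i_rels_def H1i_arith)
  from theI'[OF ex1_cnj_antihom[OF this]]
  show "cnj_antihom (star_II \<alpha> \<beta> \<gamma> \<delta>)" "star_II \<alpha> \<beta> \<gamma> \<delta> K = - K"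
    "star_II \<alpha> \<beta> \<gamma> \<delta> E = \<alpha> *\<^sub>C (K * E) + \<beta> *\<^sub>C F"
    "star_II \<alpha> \<beta> \<gamma> \<delta> F = \<gamma> *\<^sub>C E + \<delta> *\<^sub>C (K * F)"
    by (simp_all add: star_II_def)
qed

lemmas star_I_simps = cnj_antihomD[OF star_I_antihom] star_I_gens
lemmas star_II_simps = cnj_antihomD[OF star_II_antihom] star_II_gens

lemma star_I_eqI:
  assumes "cnj_antihom \<Gamma>" "\<Gamma> K = K" "\<Gamma> E = \<alpha> *\<^sub>C E - \<beta> *\<^sub>C (K * F)"
    "\<Gamma> F = \<delta> *\<^sub>C F - \<gamma> *\<^sub>C (K * E)"
  shows "\<Gamma> = star_I \<alpha> \<beta> \<gamma> \<delta>"
  by (rule cnj_antihom_eqI) (use assms in \<open>simp_all add: star_I_antihom star_I_gens\<close>)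

lemma star_II_eqI:
  assumes "cnj_antihom \<Gamma>" "\<Gamma> K = - K" "\<Gamma> E = \<alpha> *\<^sub>C (K * E) + \<beta> *\<^sub>C F"
    "\<Gamma> F = \<gamma> *\<^sub>C E + \<delta> *\<^sub>C (K * F)"
  shows "\<Gamma> = star_II \<alpha> \<beta> \<gamma> \<delta>"
  by (rule cnj_antihom_eqI) (use assms in \<open>simp_all add: star_II_antihom star_II_gens\<close>)

lemma star_I_inject:
  "star_I \<alpha> \<beta> \<gamma> \<delta> = star_I \<alpha>' \<beta>' \<gamma>' \<delta>' \<longleftrightarrow> \<alpha> = \<alpha>' \<and> \<beta> = \<beta>' \<and> \<gamma> = \<gamma>' \<and> \<delta> = \<delta>'"
proof
  assume eq: "star_I \<alpha> \<beta> \<gamma> \<delta> = star_I \<alpha>' \<beta>' \<gamma>' \<delta>'"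
  from fun_cong[OF eq, of E] fun_cong[OF eq, of F]
  show "\<alpha> = \<alpha>' \<and> \<beta> = \<beta>' \<and> \<gamma> = \<gamma>' \<and> \<delta> = \<delta>'"
    by (simp add: star_I_gens H1i_arith)
qed simp

lemma table_star_I: "table_I \<alpha> \<beta> \<gamma> \<delta> (\<alpha> * \<delta> - \<beta> * \<gamma>) (star_I \<alpha> \<beta> \<gamma> \<delta>)"
  unfolding table_I_def
  by (simp add: e0_def e1_def E0_def E1_def F0_def F1_def C0_def C1_def star_I_simps H1i_arith
      algebra_simps)

lemma table_star_II: "table_II \<alpha> \<beta> \<gamma> \<delta> (- (\<alpha> * \<delta> - \<beta> * \<gamma>)) (star_II \<alpha> \<beta> \<gamma> \<delta>)"
  unfolding table_II_def
  by (simp add: e0_def e1_def E0_def E1_def F0_def F1_def C0_def C1_def star_II_simps H1i_arith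
      algebra_simps)

text \<open>A table prescribes an antilinear map on a basis. With the determinant as coefficient of
  \<open>C0\<close> and \<open>C1\<close>, the map is automatically antimultiplicative, although the
  table does not ask for it.\<close>

lemma table_I_iff:
  "semilinear cnj \<Gamma> \<and> table_I \<alpha> \<beta> \<gamma> \<delta> (\<alpha> * \<delta> - \<beta> * \<gamma>) \<Gamma> \<longleftrightarrow> \<Gamma> = star_I \<alpha> \<beta> \<gamma> \<delta>"
proof
  assume "semilinear cnj \<Gamma> \<and> table_I \<alpha> \<beta> \<gamma> \<delta> (\<alpha> * \<delta> - \<beta> * \<gamma>) \<Gamma>"
  then show "\<Gamma> = star_I \<alpha> \<beta> \<gamma> \<delta>"
    using star_I_antihom[of \<alpha> \<beta> \<gamma> \<delta>] table_star_I[of \<alpha> \<beta> \<gamma> \<delta>]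
    by (intro semilinear_eqI[of cnj]) (simp_all add: table_I_def cnj_antihom_def)
qed (use star_I_antihom[of \<alpha> \<beta> \<gamma> \<delta>] table_star_I in \<open>simp add: cnj_antihom_def\<close>)

lemma table_II_iff:
  "semilinear cnj \<Gamma> \<and> table_II \<alpha> \<beta> \<gamma> \<delta> (- (\<alpha> * \<delta> - \<beta> * \<gamma>)) \<Gamma> \<longleftrightarrow> \<Gamma> = star_II \<alpha> \<beta> \<gamma> \<delta>"
proof
  assume "semilinear cnj \<Gamma> \<and> table_II \<alpha> \<beta> \<gamma> \<delta> (- (\<alpha> * \<delta> - \<beta> * \<gamma>)) \<Gamma>"
  then show "\<Gamma> = star_II \<alpha> \<beta> \<gamma> \<delta>"
    using star_II_antihom[of \<alpha> \<beta> \<gamma> \<delta>] table_star_II[of \<alpha> \<beta> \<gamma> \<delta>]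
    by (intro semilinear_eqI[of cnj]) (simp_all add: table_II_def cnj_antihom_def)
qed (use star_II_antihom[of \<alpha> \<beta> \<gamma> \<delta>] table_star_II[of \<alpha> \<beta> \<gamma> \<delta>] in \<open>simp add: cnj_antihom_def\<close>)

section \<open>Involutivity in terms of the coefficients, and their polar form\<close>

definition involutive_coeffs :: "complex \<Rightarrow> complex \<Rightarrow> complex \<Rightarrow> complex \<Rightarrow> bool" where
  "involutive_coeffs \<alpha> \<beta> \<gamma> \<delta> \<longleftrightarrow> cnj \<alpha> * \<alpha> - cnj \<beta> * \<gamma> = 1 \<and> cnj \<delta> * \<delta> - cnj \<gamma> * \<beta> = 1 \<and>
     cnj \<beta> * \<delta> = cnj \<alpha> * \<beta> \<and> cnj \<gamma> * \<alpha> = cnj \<delta> * \<gamma>"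

lemma hom_eq_id_iff:
  assumes "algebra_hom T"
  shows "T = id \<longleftrightarrow> T K = K \<and> T E = E \<and> T F = F"
  using algebra_hom_eqI[OF assms algebra_hom_id] by (auto simp: id_def)

text \<open>The square of an antilinear antihomomorphism is a homomorphism, so it suffices to look
  at the generators. For the matrix M with rows (\<alpha>, \<beta>) and (\<gamma>, \<delta>), D =
  diag(1, -1) and entrywise conjugation, the resulting four equations are the entries of conj(M) D M
  = D.\<close>

lemma star_I_involutive_iff:
  "star_I \<alpha> \<beta> \<gamma> \<delta> \<circ> star_I \<alpha> \<beta> \<gamma> \<delta> = id \<longleftrightarrow> involutive_coeffs \<alpha> \<beta> \<gamma> \<delta>"
  unfolding hom_eq_id_iff[OF cnj_antihom_comp[OF star_I_antihom star_I_antihom]]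
  by (auto simp: star_I_simps H1i_arith involutive_coeffs_def algebra_simps)

lemma involutive_coeffs_II_iff:
  "involutive_coeffs \<alpha> (- \<i> * \<beta>) (\<i> * \<gamma>) \<delta> \<longleftrightarrow> cnj \<alpha> * \<alpha> + cnj \<beta> * \<gamma> = 1 \<and>
     cnj \<delta> * \<delta> + cnj \<gamma> * \<beta> = 1 \<and> cnj \<beta> * \<delta> + cnj \<alpha> * \<beta> = 0 \<and> cnj \<gamma> * \<alpha> + cnj \<delta> * \<gamma> = 0"
proof -
  \<comment> \<open>In the two off-diagonal equations the sides acquire the factors
    \<open>\<i>\<close> and \<open>- \<i>\<close>; cancelling turns the difference into a
    sum.\<close>
  have *: "\<i> * x = - (\<i> * y) \<longleftrightarrow> x + y = 0" "- (\<i> * x) = \<i> * y \<longleftrightarrow> x + y = 0" for x y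
    by (auto simp: eq_neg_iff_add_eq_0 neg_eq_iff_add_eq_0 simp flip: distrib_left)
  have "cnj (- \<i> * \<beta>) * \<delta> = \<i> * (cnj \<beta> * \<delta>)" "cnj \<alpha> * (- \<i> * \<beta>) = - (\<i> * (cnj \<alpha> * \<beta>))"
    "cnj (\<i> * \<gamma>) * \<alpha> = - (\<i> * (cnj \<gamma> * \<alpha>))" "cnj \<delta> * (\<i> * \<gamma>) = \<i> * (cnj \<delta> * \<gamma>)"
    "cnj (- \<i> * \<beta>) * (\<i> * \<gamma>) = - (cnj \<beta> * \<gamma>)" "cnj (\<i> * \<gamma>) * (- \<i> * \<beta>) = - (cnj \<gamma> * \<beta>)"
    by (simp_all add: algebra_simps)
  then show ?thesis
    unfolding involutive_coeffs_def by (simp only: * diff_minus_eq_add)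
qed

lemma star_II_involutive_iff:
  "star_II \<alpha> \<beta> \<gamma> \<delta> \<circ> star_II \<alpha> \<beta> \<gamma> \<delta> = id \<longleftrightarrow>
     involutive_coeffs \<alpha> (- \<i> * \<beta>) (\<i> * \<gamma>) \<delta>"
  unfolding hom_eq_id_iff[OF cnj_antihom_comp[OF star_II_antihom star_II_antihom]]
    involutive_coeffs_II_iff
  by (simp add: star_II_simps H1i_arith, simp only: neg_eq_iff_add_eq_0 add.commute
      conj_ac conj_absorb conj_left_absorb)

text \<open>A nonnegative number with a free sign is an arbitrary real number: \<open>r\<close> and
  \<open>u\<close> stand for \<open>s * b\<close> and \<open>t * c\<close>.\<close>

lemma coeffs_I_iff_ex:
  "(\<exists>a b c \<phi> \<psi> s t. coeffs_I a b c \<phi> \<psi> s t \<alpha> \<beta> \<gamma> \<delta> \<mu>) \<longleftrightarrow>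
   (\<exists>a r u \<phi> \<psi>. 0 \<le> a \<and> a\<^sup>2 - r * u = 1 \<and> \<alpha> = of_real a * cis \<phi> \<and>
      \<beta> = of_real r * cis ((\<phi> + \<psi>) / 2) \<and> \<gamma> = of_real u * cis ((\<phi> + \<psi>) / 2) \<and>
      \<delta> = of_real a * cis \<psi>) \<and> \<mu> = \<alpha> * \<delta> - \<beta> * \<gamma>" (is "?L \<longleftrightarrow> ?R \<and> ?M")
proof (intro iffI conjI)
  assume ?L
  then obtain a b c \<phi> \<psi> s t where c: "coeffs_I a b c \<phi> \<psi> s t \<alpha> \<beta> \<gamma> \<delta> \<mu>" by blast
  then show ?M unfolding coeffs_I_def by blast
  have "0 \<le> a \<and> a\<^sup>2 - (s * b) * (t * c) = 1 \<and> \<alpha> = of_real a * cis \<phi> \<and>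
      \<beta> = of_real (s * b) * cis ((\<phi> + \<psi>) / 2) \<and> \<gamma> = of_real (t * c) * cis ((\<phi> + \<psi>) / 2) \<and>
      \<delta> = of_real a * cis \<psi>"
    using c unfolding coeffs_I_def of_real_mult by blast
  then show ?R by blast
next
  assume "?R \<and> ?M"
  then obtain a r u \<phi> \<psi> where *: "0 \<le> a" "a\<^sup>2 - r * u = 1" "\<alpha> = of_real a * cis \<phi>"
    "\<beta> = of_real r * cis ((\<phi> + \<psi>) / 2)" "\<gamma> = of_real u * cis ((\<phi> + \<psi>) / 2)"
    "\<delta> = of_real a * cis \<psi>" "\<mu> = \<alpha> * \<delta> - \<beta> * \<gamma>"
    by blast
  have sign: "\<exists>s\<in>{-1, 1}. x = s * \<bar>x\<bar>" for x :: real
    by (cases "x \<ge> 0") auto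
  obtain s t where st: "s \<in> {-1, 1}" "r = s * \<bar>r\<bar>" "t \<in> {-1, 1}" "u = t * \<bar>u\<bar>"
    using sign[of r] sign[of u] by blast
  have "a\<^sup>2 - (s * \<bar>r\<bar>) * (t * \<bar>u\<bar>) = 1" "\<beta> = of_real s * of_real \<bar>r\<bar> * cis ((\<phi> + \<psi>) / 2)"
    "\<gamma> = of_real t * of_real \<bar>u\<bar> * cis ((\<phi> + \<psi>) / 2)"
    using *(2,4,5) st(2,4) by (simp_all flip: of_real_mult)
  then have "coeffs_I a \<bar>r\<bar> \<bar>u\<bar> \<phi> \<psi> s t \<alpha> \<beta> \<gamma> \<delta> \<mu>"
    unfolding coeffs_I_def using *(1,3,6,7) st(1,3) by simp
  then show ?L by blast
qed

text \<open>The diagonal equations give equal moduli of \<alpha> and \<delta>. The off-diagonal ones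
  say that \<beta> and \<gamma>, divided by \<open>cis ((\<phi> + \<psi>) / 2)\<close>, equal their
  own conjugates, provided that \<alpha> is not zero. If \<alpha> vanishes, the phases are free and
  are chosen to fit \<beta>.\<close>

lemma involutive_coeffs_iff:
  "involutive_coeffs \<alpha> \<beta> \<gamma> \<delta> \<longleftrightarrow> (\<exists>a r u \<phi> \<psi>. 0 \<le> a \<and> a\<^sup>2 - r * u = 1 \<and>
     \<alpha> = of_real a * cis \<phi> \<and> \<beta> = of_real r * cis ((\<phi> + \<psi>) / 2) \<and>
     \<gamma> = of_real u * cis ((\<phi> + \<psi>) / 2) \<and> \<delta> = of_real a * cis \<psi>)" (is "_ \<longleftrightarrow> ?R")
proof
  assume inv: "involutive_coeffs \<alpha> \<beta> \<gamma> \<delta>"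
  then have eqs: "cnj \<alpha> * \<alpha> - cnj \<beta> * \<gamma> = 1" "cnj \<delta> * \<delta> - cnj \<gamma> * \<beta> = 1"
     "cnj \<beta> * \<delta> = cnj \<alpha> * \<beta>" "cnj \<gamma> * \<alpha> = cnj \<delta> * \<gamma>"
    by (simp_all add: involutive_coeffs_def)
  \<comment> \<open>The products \<open>cnj \<beta> * \<gamma>\<close> and
    \<open>cnj \<gamma> * \<beta>\<close> in the first two equations are conjugate to each
    other.\<close>
  have "cnj \<delta> * \<delta> = cnj (cnj \<alpha> * \<alpha>)"
    using eqs(1,2) by (metis complex_cnj_cnj complex_cnj_diff complex_cnj_mult complex_cnj_one
        diff_eq_eq mult.commute)
  then have norm: "cmod \<delta> = cmod \<alpha>"
    by (simp add: mult.commute[of "cnj _"] flip: complex_norm_square of_real_power)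
  show ?R
  proof (cases "\<alpha> = 0")
    case True
    then have "\<delta> = 0" using norm by simp
    have bg: "cnj \<beta> * \<gamma> = -1" using eqs(1) True by (simp add: algebra_simps minus_equation_iff)
    then have "\<beta> \<noteq> 0" by auto
    \<comment> \<open>Both phases are taken to be \<open>Arg \<beta>\<close>, so that their half sum
      is \<open>Arg \<beta>\<close> again. Then \<open>cnj \<beta> * \<gamma> = -1\<close> forces
      \<gamma> to be a negative multiple of the same phase.\<close>
    have "\<beta> = of_real (cmod \<beta>) * cis ((Arg \<beta> + Arg \<beta>) / 2)"
      using rcis_cmod_Arg[of \<beta>] by (simp add: rcis_def)
    moreover from this have "\<gamma> = of_real (- (1 / cmod \<beta>)) * cis ((Arg \<beta> + Arg \<beta>) / 2)"
    proof -
      let ?h = "(Arg \<beta> + Arg \<beta>) / 2"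
      have "cnj \<beta> = of_real (cmod \<beta>) * cis (- ?h)"
        by (subst \<open>\<beta> = _\<close>) (simp add: cis_cnj)
      then have "of_real (cmod \<beta>) * cis (- ?h) * \<gamma> * cis ?h = - cis ?h"
        using bg by simp
      moreover have "of_real (cmod \<beta>) * cis (- ?h) * \<gamma> * cis ?h =
          of_real (cmod \<beta>) * \<gamma> * (cis (- ?h) * cis ?h)"
        by (simp only: mult_ac)
      ultimately have "of_real (cmod \<beta>) * \<gamma> = - cis ?h"
        by (simp add: cis_mult)
      with \<open>\<beta> \<noteq> 0\<close> show ?thesis by (simp add: field_simps)
    qed
    ultimately show ?thesis
      using True \<open>\<delta> = 0\<close> \<open>\<beta> \<noteq> 0\<close>
      by (intro exI[of _ 0] exI[of _ "cmod \<beta>"] exI[of _ "- (1 / cmod \<beta>)"] exI[of _ "Arg \<beta>"]) auto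
  next
    case False
    define \<phi> \<psi> h where "\<phi> = Arg \<alpha>" "\<psi> = Arg \<delta>" "h = (\<phi> + \<psi>) / 2"
    note polar = \<phi>_\<psi>_h_def(1,2)
    have \<alpha>: "\<alpha> = of_real (cmod \<alpha>) * cis \<phi>" and \<delta>: "\<delta> = of_real (cmod \<alpha>) * cis \<psi>"
      using rcis_cmod_Arg[of \<alpha>] rcis_cmod_Arg[of \<delta>] norm by (simp_all add: rcis_def polar)
    have phase: "\<exists>r. z = of_real r * cis h" if "cnj z * \<delta> = cnj \<alpha> * z" for z
    proof -
      have "of_real (cmod \<alpha>) * (cnj z * cis \<psi>) = of_real (cmod \<alpha>) * (cis (- \<phi>) * z)"
        using that by (subst (asm) \<alpha>, subst (asm) \<delta>) (simp add: mult_ac cis_cnj)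
      then have "cnj z * cis \<psi> = cis (- \<phi>) * z" using False by simp
      \<comment> \<open>The factor \<open>cis (h - \<psi>)\<close> makes the equation symmetric,
        because \<open>h - \<psi> - \<phi> = - h\<close>: the two sides become conjugates of each
        other.\<close>
      then have "cnj z * (cis \<psi> * cis (h - \<psi>)) = z * (cis (- \<phi>) * cis (h - \<psi>))"
        by (simp add: mult_ac)
      moreover have "cis \<psi> * cis (h - \<psi>) = cis h" "cis (- \<phi>) * cis (h - \<psi>) = cis (- h)"
        unfolding cis_mult by (rule arg_cong[of _ _ cis], simp add: \<phi>_\<psi>_h_def(3) field_simps)+
      ultimately have "cnj z * cis h = z * cis (- h)" by simp
      then have "cnj (z * cis (- h)) = z * cis (- h)" by (simp add: cis_cnj)
      then obtain r where "z * cis (- h) = of_real r"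
        by (metis Reals_cases Reals_cnj_iff)
      then have "z * cis (- h) * cis h = of_real r * cis h" by simp
      then show ?thesis by (auto simp: mult.assoc cis_mult)
    qed
    \<comment> \<open>The fourth equation has \<alpha> and \<delta> exchanged compared with the
      third. Multiplying by \<open>cnj \<alpha> * \<alpha>\<close>, which equals
      \<open>cnj \<delta> * \<delta>\<close>, brings it to the form required by
      \<open>phase\<close>.\<close>
    have "cnj \<gamma> * \<delta> = cnj \<alpha> * \<gamma>"
    proof -
      have "cnj \<gamma> * \<delta> * (cnj \<alpha> * \<alpha>) = cnj \<alpha> * \<delta> * (cnj \<gamma> * \<alpha>)"
        by (simp only: mult_ac)
      also have "\<dots> = cnj \<alpha> * \<gamma> * (cnj \<delta> * \<delta>)"
        unfolding eqs(4) by (simp only: mult_ac)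
      also have "cnj \<delta> * \<delta> = cnj \<alpha> * \<alpha>"
        using \<open>cnj \<delta> * \<delta> = cnj (cnj \<alpha> * \<alpha>)\<close> by (simp add: mult.commute)
      finally show ?thesis using False by simp
    qed
    then obtain r u where ru: "\<beta> = of_real r * cis h" "\<gamma> = of_real u * cis h"
      using phase[OF eqs(3)] phase[of \<gamma>] by auto
    have "complex_of_real ((cmod \<alpha>)\<^sup>2 - r * u) = of_real 1"
    proof -
      have "cnj \<beta> * \<gamma> = of_real (r * u) * (cis (- h) * cis h)"
        unfolding ru by (simp add: cis_cnj mult_ac)
      then have "cnj \<beta> * \<gamma> = of_real (r * u)" by (simp add: cis_mult)
      then show ?thesis
        using eqs(1) by (simp add: mult.commute[of "cnj _"] flip: complex_norm_square)
    qed
    then have "(cmod \<alpha>)\<^sup>2 - r * u = 1" by (simp only: of_real_eq_iff)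
    with \<alpha> \<delta> ru show ?thesis
      unfolding \<phi>_\<psi>_h_def(3)
      by (intro exI[of _ "cmod \<alpha>"] exI[of _ r] exI[of _ u] exI[of _ \<phi>] exI[of _ \<psi>]) auto
  qed
next
  assume ?R
  then obtain a r u \<phi> \<psi> where *: "a\<^sup>2 - r * u = 1"
     "\<alpha> = of_real a * cis \<phi>" "\<beta> = of_real r * cis ((\<phi> + \<psi>) / 2)"
     "\<gamma> = of_real u * cis ((\<phi> + \<psi>) / 2)" "\<delta> = of_real a * cis \<psi>"
    by blast
  have "complex_of_real a * of_real a - of_real r * of_real u = 1"
    using *(1) by (metis of_real_1 of_real_diff of_real_mult power2_eq_square)
  then show "involutive_coeffs \<alpha> \<beta> \<gamma> \<delta>"
    unfolding involutive_coeffs_def *(2-)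
    by (simp add: cis_cnj cis_mult mult_ac)
      (simp add: mult.left_commute[of "cis _"] cis_mult field_simps)
qed

text \<open>The factors \<open>- \<i>\<close> and \<open>\<i>\<close> remove the imaginary unit from
  \<beta> and \<gamma>, the second one at the cost of the sign \<open>t\<close>. This flips the sign
  in the quadratic constraint, while the product \<beta>\<gamma> stays the same.\<close>

lemma coeffs_II_eq:
  "coeffs_II a b c \<phi> \<psi> s t \<alpha> \<beta> \<gamma> \<delta> \<mu> \<longleftrightarrow>
   coeffs_I a b c \<phi> \<psi> s (- t) \<alpha> (- \<i> * \<beta>) (\<i> * \<gamma>) \<delta> (- \<mu>)"
proof -
  have *: "- \<i> * x = y \<longleftrightarrow> x = \<i> * y" "\<i> * x = - y \<longleftrightarrow> x = \<i> * y" for x y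
    by (auto simp: complex_eq_iff)
  have "\<beta> = s * \<i> * b * cis ((\<phi> + \<psi>) / 2) \<longleftrightarrow> - \<i> * \<beta> = s * b * cis ((\<phi> + \<psi>) / 2)"
    unfolding *(1) by (simp add: mult_ac)
  moreover have "\<gamma> = t * \<i> * c * cis ((\<phi> + \<psi>) / 2) \<longleftrightarrow>
      \<i> * \<gamma> = complex_of_real (- t) * c * cis ((\<phi> + \<psi>) / 2)"
    unfolding of_real_minus mult_minus_left *(2) by (simp add: mult_ac)
  moreover have "- \<mu> = \<alpha> * \<delta> - - \<i> * \<beta> * (\<i> * \<gamma>) \<longleftrightarrow> \<mu> = - (\<alpha> * \<delta> - \<beta> * \<gamma>)"
    by (auto simp: algebra_simps)
  moreover have "- t \<in> {-1, 1} \<longleftrightarrow> t \<in> {-1, 1}" by auto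
  ultimately show ?thesis
    unfolding coeffs_I_def coeffs_II_def by simp
qed

text \<open>Both products \<alpha>\<delta> and \<beta>\<gamma> have phase
  \<open>\<phi> + \<psi>\<close> up to real factors, and the quadratic constraint says that the
  difference of these real factors is 1.\<close>

lemma coeffs_I_mu:
  assumes "coeffs_I a b c \<phi> \<psi> s t \<alpha> \<beta> \<gamma> \<delta> \<mu>"
  shows "\<mu> = cis (\<phi> + \<psi>)"
proof -
  have "\<mu> = of_real (a\<^sup>2 - (s * b) * (t * c)) * cis (\<phi> + \<psi>)"
  proof -
    have "cis ((\<phi> + \<psi>) / 2) * cis ((\<phi> + \<psi>) / 2) = cis (\<phi> + \<psi>)" "cis \<phi> * cis \<psi> = cis (\<phi> + \<psi>)"
      by (simp_all add: cis_mult)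
    moreover have "\<mu> = of_real (a\<^sup>2) * (cis \<phi> * cis \<psi>) -
        of_real ((s * b) * (t * c)) * (cis ((\<phi> + \<psi>) / 2) * cis ((\<phi> + \<psi>) / 2))"
      using assms unfolding coeffs_I_def by (simp add: power2_eq_square mult_ac)
    ultimately show ?thesis by (simp add: left_diff_distrib)
  qed
  with assms show ?thesis by (simp add: coeffs_I_def)
qed

text \<open>Trades the polar parametrization for the four algebraic equations. Membership in type I
  is checked in this form below.\<close>

lemma stars_I_eq: "stars_I = {star_I \<alpha> \<beta> \<gamma> \<delta> | \<alpha> \<beta> \<gamma> \<delta>. involutive_coeffs \<alpha> \<beta> \<gamma> \<delta>}"
proof -
  have "\<Gamma> \<in> stars_I \<longleftrightarrow> (\<exists>\<alpha> \<beta> \<gamma> \<delta> \<mu>. (\<exists>a b c \<phi> \<psi> s t. coeffs_I a b c \<phi> \<psi> s t \<alpha> \<beta> \<gamma> \<delta> \<mu>) \<and>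
      (semilinear cnj \<Gamma> \<and> table_I \<alpha> \<beta> \<gamma> \<delta> \<mu> \<Gamma>))" for \<Gamma>
    unfolding stars_I_def by blast
  also have "\<dots> \<Gamma> \<longleftrightarrow> (\<exists>\<alpha> \<beta> \<gamma> \<delta>. involutive_coeffs \<alpha> \<beta> \<gamma> \<delta> \<and> \<Gamma> = star_I \<alpha> \<beta> \<gamma> \<delta>)" for \<Gamma>
    unfolding coeffs_I_iff_ex involutive_coeffs_iff[symmetric] table_I_iff[symmetric] by blast
  finally show ?thesis by blast
qed

lemma stars_II_eq:
  "stars_II = {star_II \<alpha> \<beta> \<gamma> \<delta> | \<alpha> \<beta> \<gamma> \<delta>. involutive_coeffs \<alpha> (- \<i> * \<beta>) (\<i> * \<gamma>) \<delta>}"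
proof -
  have ex: "(\<exists>a b c \<phi> \<psi> s t. coeffs_II a b c \<phi> \<psi> s t \<alpha> \<beta> \<gamma> \<delta> \<mu>) \<longleftrightarrow>
      involutive_coeffs \<alpha> (- \<i> * \<beta>) (\<i> * \<gamma>) \<delta> \<and> \<mu> = - (\<alpha> * \<delta> - \<beta> * \<gamma>)" for \<alpha> \<beta> \<gamma> \<delta> \<mu>
  proof -
    have "(\<exists>a b c \<phi> \<psi> s t. coeffs_II a b c \<phi> \<psi> s t \<alpha> \<beta> \<gamma> \<delta> \<mu>) \<longleftrightarrow>
        (\<exists>a b c \<phi> \<psi> s t. coeffs_I a b c \<phi> \<psi> s t \<alpha> (- \<i> * \<beta>) (\<i> * \<gamma>) \<delta> (- \<mu>))"
      unfolding coeffs_II_eq by (metis minus_minus)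
    also have "\<dots> \<longleftrightarrow> involutive_coeffs \<alpha> (- \<i> * \<beta>) (\<i> * \<gamma>) \<delta> \<and>
        - \<mu> = \<alpha> * \<delta> - (- \<i> * \<beta>) * (\<i> * \<gamma>)"
      unfolding coeffs_I_iff_ex involutive_coeffs_iff[symmetric] ..
    also have "- \<mu> = \<alpha> * \<delta> - (- \<i> * \<beta>) * (\<i> * \<gamma>) \<longleftrightarrow> \<mu> = - (\<alpha> * \<delta> - \<beta> * \<gamma>)"
      by (auto simp: algebra_simps)
    finally show ?thesis .
  qed
  have "\<Gamma> \<in> stars_II \<longleftrightarrow> (\<exists>\<alpha> \<beta> \<gamma> \<delta> \<mu>. (\<exists>a b c \<phi> \<psi> s t. coeffs_II a b c \<phi> \<psi> s t \<alpha> \<beta> \<gamma> \<delta> \<mu>) \<and>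
      (semilinear cnj \<Gamma> \<and> table_II \<alpha> \<beta> \<gamma> \<delta> \<mu> \<Gamma>))" for \<Gamma>
    unfolding stars_II_def by blast
  also have "\<dots> \<Gamma> \<longleftrightarrow> (\<exists>\<alpha> \<beta> \<gamma> \<delta>. involutive_coeffs \<alpha> (- \<i> * \<beta>) (\<i> * \<gamma>) \<delta> \<and>
      \<Gamma> = star_II \<alpha> \<beta> \<gamma> \<delta>)" for \<Gamma>
    unfolding ex table_II_iff[symmetric] by blast
  finally show ?thesis by blast
qed

section \<open>Automorphisms commuting with the antipode\<close>

lemma involutory_bij: "f \<circ> f = id \<Longrightarrow> bij f"
  by (rule o_bij)

lemma I_op_antihom: "cnj_antihom I_op" and I_op_I_op: "I_op \<circ> I_op = id"
  using I_op_spec(1) by (simp_all add: star_op_iff)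

lemma I_op_eq: "I_op = star_I 1 0 0 1"
  by (rule star_I_eqI) (simp_all add: I_op_antihom I_op_spec)

section \<open>The antipode in coordinates\<close>

lemma algebra_antihomD:
  assumes "algebra_antihom f"
  shows "f (x + y) = f x + f y" "f (x - y) = f x - f y" "f (- x) = - f x" "f 0 = 0"
    "f (c *\<^sub>C x) = c *\<^sub>C f x" "f (x * y) = f y * f x" "f 1 = 1"
  using assms semilinear_simps[of id f] by (auto simp: algebra_antihom_def antimultiplicative_def)

lemmas antipode_simps = algebra_antihomD[OF antipode_spec(1)] antipode_spec(2-4)

lemma antipode_basis:
  "antipode e0 = e0" "antipode e1 = e1" "antipode E0 = E1" "antipode E1 = - E0"
  "antipode F0 = - F1" "antipode F1 = F0" "antipode C0 = C0" "antipode C1 = C1"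
  by (simp_all add: e0_def e1_def E0_def E1_def F0_def F1_def C0_def C1_def antipode_simps
      H1i_arith)

lemma coordinates_antipode:
  "coordinates (antipode x) = (let v = coordinates x in
     Coords (c_e0 v) (c_e1 v) (- c_E1 v) (c_E0 v) (c_F1 v) (- c_F0 v) (c_C0 v) (c_C1 v))"
proof -
  have "antipode x = antipode (of_coords (coordinates x))" by simp
  then show ?thesis
    by (simp add: of_coords_def antipode_simps antipode_basis coords_defs Let_def)
qed

section \<open>Classification of the automorphisms commuting with the antipode\<close>

lemma AutS_hom: "\<phi> \<in> AutS \<Longrightarrow> algebra_hom \<phi>"
  and AutS_antipode: "\<phi> \<in> AutS \<Longrightarrow> \<phi> (antipode x) = antipode (\<phi> x)"
  and AutS_inject: "\<phi> \<in> AutS \<Longrightarrow> \<phi> x = \<phi> y \<longleftrightarrow> x = y"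
  by (auto simp: AutS_def bij_def inj_def o_def fun_eq_iff)

lemma AutS_cases: "AutS = AutS_I \<union> AutS_II"
proof -
  have "\<phi> e0 = e0 \<or> \<phi> e0 = e1" if \<phi>: "\<phi> \<in> AutS" for \<phi>
  proof -
    obtain v where v: "coordinates (\<phi> e0) = v" by blast
    have "antipode (antipode (\<phi> e0)) = \<phi> e0"
      by (simp add: antipode_basis flip: AutS_antipode[OF \<phi>])
    then have odd: "c_E0 v = 0" "c_E1 v = 0" "c_F0 v = 0" "c_F1 v = 0"
      by (cases v, simp add: H1i_eq_iff coordinates_antipode v Let_def)+
    have "\<phi> e0 * \<phi> e0 = \<phi> (e0 * e0)" by (simp add: algebra_homD[OF AutS_hom[OF \<phi>]])
    then have "v * v = v" by (simp add: basis_mult H1i_eq_iff v)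
    \<comment> \<open>The \<open>C0\<close> component reads
      \<open>2 * c_e0 v * c_C0 v = c_C0 v\<close> once the odd components vanish, and
      \<open>2 * c_e0 v\<close> is 0 or 2, never 1. The same holds for \<open>C1\<close>.\<close>
    then have idem: "c_e0 v \<in> {0, 1}" "c_e1 v \<in> {0, 1}" "c_C0 v = 0" "c_C1 v = 0"
      using odd by (cases v; auto simp: times_coords_def)+
    \<comment> \<open>Injectivity rules out the trivial idempotents.\<close>
    have "\<phi> e0 \<noteq> \<phi> 0" "\<phi> e0 \<noteq> \<phi> 1"
      unfolding AutS_inject[OF \<phi>] by (simp_all add: H1i_arith)
    then have "v \<noteq> 0" "v \<noteq> 1"
      by (simp_all add: algebra_homD[OF AutS_hom[OF \<phi>]] H1i_eq_iff v)
    with odd idem show ?thesis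
      by (cases v) (auto simp: H1i_eq_iff v coords_defs)
  qed
  then show ?thesis by (auto simp: AutS_I_def AutS_II_def)
qed

lemma AutS_odd:
  assumes \<phi>: "\<phi> \<in> AutS" and x: "antipode (antipode x) = - x"
  obtains p q r s where "\<phi> x = p *\<^sub>C E0 + q *\<^sub>C E1 + r *\<^sub>C F0 + s *\<^sub>C F1"
proof
  let ?v = "coordinates (\<phi> x)"
  have "antipode (antipode (\<phi> x)) = - \<phi> x"
    by (simp add: x algebra_homD[OF AutS_hom[OF \<phi>]] flip: AutS_antipode[OF \<phi>])
  then have "c_e0 ?v = 0" "c_e1 ?v = 0" "c_C0 ?v = 0" "c_C1 ?v = 0"
    by (simp_all add: H1i_arith coordinates_antipode Let_def)
  then show "\<phi> x = c_E0 ?v *\<^sub>C E0 + c_E1 ?v *\<^sub>C E1 + c_F0 ?v *\<^sub>C F0 + c_F1 ?v *\<^sub>C F1"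
    by (simp add: H1i_arith coords.expand)
qed

lemma K_e0: "K = 2 *\<^sub>C e0 - 1"
  by (simp add: H1i_arith)

lemma antipode_antipode_EF: "antipode (antipode E) = - E" "antipode (antipode F) = - F"
  by (simp_all add: antipode_simps H1i_arith)

lemma AutS_I_star:
  assumes "\<phi> \<in> AutS_I"
  obtains \<alpha> \<beta> \<gamma> \<delta> where "I_op \<circ> \<phi> = star_I \<alpha> \<beta> \<gamma> \<delta>"
proof -
  have \<phi>: "\<phi> \<in> AutS" and e0: "\<phi> e0 = e0" using assms by (auto simp: AutS_I_def)
  note hom = algebra_homD[OF AutS_hom[OF \<phi>]]
  have K: "\<phi> K = K" by (simp add: K_e0 hom e0)
  obtain p q r s where E: "\<phi> E = p *\<^sub>C E0 + q *\<^sub>C E1 + r *\<^sub>C F0 + s *\<^sub>C F1"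
    using AutS_odd[OF \<phi> antipode_antipode_EF(1)] .
  \<comment> \<open>Commutation with the antipode halves the free coefficients of the image of
    \<open>E\<close>. Only two components are compared; the others repeat the same
    relations.\<close>
  have "antipode (\<phi> E) = - (K * \<phi> E)"
    by (simp add: antipode_simps hom K flip: AutS_antipode[OF \<phi>])
  from arg_cong[OF this, of "c_E1 \<circ> coordinates"] arg_cong[OF this, of "c_F0 \<circ> coordinates"]
  have "q = p" "s = - r"
    by (simp_all add: E antipode_simps antipode_basis coords_defs)
  obtain p' q' r' s' where F: "\<phi> F = p' *\<^sub>C E0 + q' *\<^sub>C E1 + r' *\<^sub>C F0 + s' *\<^sub>C F1"
    using AutS_odd[OF \<phi> antipode_antipode_EF(2)] .
  have "antipode (\<phi> F) = - (\<phi> F * K)"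
    by (simp add: antipode_simps hom K flip: AutS_antipode[OF \<phi>])
  from arg_cong[OF this, of "c_E1 \<circ> coordinates"] arg_cong[OF this, of "c_F0 \<circ> coordinates"]
  have "q' = - p'" "s' = r'"
    by (simp_all add: F antipode_simps antipode_basis coords_defs)
  have EF: "\<phi> E = p *\<^sub>C E + r *\<^sub>C (K * F)" "\<phi> F = r' *\<^sub>C F + p' *\<^sub>C (K * E)"
    unfolding E F \<open>q = p\<close> \<open>s = - r\<close> \<open>q' = - p'\<close> \<open>s' = r'\<close> by (simp_all add: H1i_arith)
  \<comment> \<open>\<open>I_op\<close> conjugates the coefficients and reverses
    \<open>K * F\<close> to \<open>F * K = - (K * F)\<close>, which accounts for the minus signs in
    \<open>star_I\<close>.\<close>
  have "I_op \<circ> \<phi> = star_I (cnj p) (cnj r) (cnj p') (cnj r')"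
    by (intro star_I_eqI cnj_antihom_comp_hom I_op_antihom AutS_hom[OF \<phi>])
      (simp_all add: K EF cnj_antihomD[OF I_op_antihom] I_op_spec, simp_all add: H1i_arith)
  then show thesis by (rule that)
qed

lemma AutS_II_star:
  assumes "\<phi> \<in> AutS_II"
  obtains \<alpha> \<beta> \<gamma> \<delta> where "I_op \<circ> \<phi> = star_II \<alpha> \<beta> \<gamma> \<delta>"
proof -
  have \<phi>: "\<phi> \<in> AutS" and e0: "\<phi> e0 = e1" using assms by (auto simp: AutS_II_def)
  note hom = algebra_homD[OF AutS_hom[OF \<phi>]]
  have K: "\<phi> K = - K" by (simp add: K_e0 hom e0) (simp add: H1i_arith)
  obtain p q r s where E: "\<phi> E = p *\<^sub>C E0 + q *\<^sub>C E1 + r *\<^sub>C F0 + s *\<^sub>C F1"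
    using AutS_odd[OF \<phi> antipode_antipode_EF(1)] .
  have "antipode (\<phi> E) = K * \<phi> E"
    by (simp add: antipode_simps hom K flip: AutS_antipode[OF \<phi>])
  from arg_cong[OF this, of "c_E1 \<circ> coordinates"] arg_cong[OF this, of "c_F0 \<circ> coordinates"]
  have "q = - p" "s = r"
    by (simp_all add: E antipode_simps antipode_basis coords_defs)
  obtain p' q' r' s' where F: "\<phi> F = p' *\<^sub>C E0 + q' *\<^sub>C E1 + r' *\<^sub>C F0 + s' *\<^sub>C F1"
    using AutS_odd[OF \<phi> antipode_antipode_EF(2)] .
  have "antipode (\<phi> F) = \<phi> F * K"
    by (simp add: antipode_simps hom K flip: AutS_antipode[OF \<phi>])
  from arg_cong[OF this, of "c_E1 \<circ> coordinates"] arg_cong[OF this, of "c_F0 \<circ> coordinates"]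
  have "q' = p'" "s' = - r'"
    by (simp_all add: F antipode_simps antipode_basis coords_defs)
  have EF: "\<phi> E = p *\<^sub>C (K * E) + r *\<^sub>C F" "\<phi> F = p' *\<^sub>C E + r' *\<^sub>C (K * F)"
    unfolding E F \<open>q = - p\<close> \<open>s = r\<close> \<open>q' = p'\<close> \<open>s' = - r'\<close> by (simp_all add: H1i_arith)
  \<comment> \<open>Here reversal changes the sign of the terms with \<open>K * E\<close> and
    \<open>K * F\<close>, hence the signs in front of \<open>cnj p\<close> and
    \<open>cnj r'\<close>.\<close>
  have "I_op \<circ> \<phi> = star_II (- cnj p) (cnj r) (cnj p') (- cnj r')"
    by (intro star_II_eqI cnj_antihom_comp_hom I_op_antihom AutS_hom[OF \<phi>])
      (simp_all add: K EF cnj_antihomD[OF I_op_antihom] I_op_spec, simp_all add: H1i_arith)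
  then show thesis by (rule that)
qed

section \<open>The involutions of both types as compositions of \<open>I_op\<close> with
  automorphisms\<close>

lemma antihom_antipode_comp:
  "algebra_hom \<phi> \<Longrightarrow> algebra_antihom (\<phi> \<circ> antipode)"
  "algebra_hom \<phi> \<Longrightarrow> algebra_antihom (antipode \<circ> \<phi>)"
  using antipode_spec(1)
  by (simp_all add: algebra_hom_def algebra_antihom_def antimultiplicative_def semilinear_def)

text \<open>Since \<open>I_op\<close> is an involution, the only candidate for the automorphism is
  \<open>I_op \<circ> \<Gamma>\<close>. It is a bijective homomorphism, and its two composites with
  the antipode are antihomomorphisms, so comparing them on the generators is enough.\<close>

lemma I_op_comp_AutS:
  assumes "cnj_antihom \<Gamma>" "\<Gamma> \<circ> \<Gamma> = id"
    and "I_op (\<Gamma> (antipode K)) = antipode (I_op (\<Gamma> K))"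
      "I_op (\<Gamma> (antipode E)) = antipode (I_op (\<Gamma> E))"
      "I_op (\<Gamma> (antipode F)) = antipode (I_op (\<Gamma> F))"
  shows "I_op \<circ> \<Gamma> \<in> AutS" "\<Gamma> = I_op \<circ> (I_op \<circ> \<Gamma>)"
proof -
  have hom: "algebra_hom (I_op \<circ> \<Gamma>)"
    using I_op_antihom assms(1) by (rule cnj_antihom_comp)
  have "(I_op \<circ> \<Gamma>) \<circ> antipode = antipode \<circ> (I_op \<circ> \<Gamma>)"
    by (rule algebra_antihom_eqI) (use assms(3-) hom in \<open>auto intro: antihom_antipode_comp\<close>)
  moreover have "bij (I_op \<circ> \<Gamma>)"
    using assms(2) I_op_I_op by (intro bij_comp involutory_bij)
  ultimately show "I_op \<circ> \<Gamma> \<in> AutS"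
    using hom by (simp add: AutS_def)
  show "\<Gamma> = I_op \<circ> (I_op \<circ> \<Gamma>)"
    using I_op_I_op by (simp add: fun_eq_iff)
qed

lemma star_I_AutS_I:
  assumes "involutive_coeffs \<alpha> \<beta> \<gamma> \<delta>"
  shows "\<exists>\<phi>\<in>AutS_I. star_I \<alpha> \<beta> \<gamma> \<delta> = I_op \<circ> \<phi>"
proof -
  let ?\<Gamma> = "star_I \<alpha> \<beta> \<gamma> \<delta>"
  have inv: "?\<Gamma> \<circ> ?\<Gamma> = id" using assms by (simp add: star_I_involutive_iff)
  have "I_op \<circ> ?\<Gamma> \<in> AutS" "?\<Gamma> = I_op \<circ> (I_op \<circ> ?\<Gamma>)"
    by (rule I_op_comp_AutS[OF star_I_antihom inv];
        simp add: antipode_simps star_I_simps cnj_antihomD[OF I_op_antihom] I_op_spec H1i_arith)+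
  moreover have "(I_op \<circ> ?\<Gamma>) e0 = e0"
    by (simp add: e0_def star_I_simps cnj_antihomD[OF I_op_antihom] I_op_spec)
  ultimately show ?thesis unfolding AutS_I_def by blast
qed

lemma star_II_AutS_II:
  assumes "involutive_coeffs \<alpha> (- \<i> * \<beta>) (\<i> * \<gamma>) \<delta>"
  shows "\<exists>\<phi>\<in>AutS_II. star_II \<alpha> \<beta> \<gamma> \<delta> = I_op \<circ> \<phi>"
proof -
  let ?\<Gamma> = "star_II \<alpha> \<beta> \<gamma> \<delta>"
  have inv: "?\<Gamma> \<circ> ?\<Gamma> = id" using assms by (simp only: star_II_involutive_iff)
  have "I_op \<circ> ?\<Gamma> \<in> AutS" "?\<Gamma> = I_op \<circ> (I_op \<circ> ?\<Gamma>)"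
    by (rule I_op_comp_AutS[OF star_II_antihom inv];
        simp add: antipode_simps star_II_simps cnj_antihomD[OF I_op_antihom] I_op_spec H1i_arith)+
  moreover have "(I_op \<circ> ?\<Gamma>) e0 = e1"
    by (simp add: e0_def e1_def star_II_simps cnj_antihomD[OF I_op_antihom] I_op_spec)
  ultimately show ?thesis unfolding AutS_II_def by blast
qed

lemma stars_I_AutS_I:
  "stars_I = {\<Gamma>. semi_hopf_star \<Gamma> \<and> (\<exists>\<phi>\<in>AutS_I. \<Gamma> = I_op \<circ> \<phi>)}" (is "_ = ?R")
proof
  show "stars_I \<subseteq> ?R"
    using star_I_AutS_I star_I_involutive_iff
    unfolding stars_I_eq semi_hopf_star_def AutS_I_def by blast
  show "?R \<subseteq> stars_I"
  proof
    fix \<Gamma> assume "\<Gamma> \<in> ?R"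
    then obtain \<phi> where "\<phi> \<in> AutS_I" "\<Gamma> = I_op \<circ> \<phi>" and inv: "\<Gamma> \<circ> \<Gamma> = id"
      unfolding semi_hopf_star_def by blast
    then obtain \<alpha> \<beta> \<gamma> \<delta> where "\<Gamma> = star_I \<alpha> \<beta> \<gamma> \<delta>" using AutS_I_star by metis
    with inv show "\<Gamma> \<in> stars_I"
      unfolding stars_I_eq using star_I_involutive_iff by blast
  qed
qed

lemma stars_II_AutS_II:
  "stars_II = {\<Gamma>. semi_hopf_star \<Gamma> \<and> (\<exists>\<phi>\<in>AutS_II. \<Gamma> = I_op \<circ> \<phi>)}" (is "_ = ?R")
proof
  show "stars_II \<subseteq> ?R"
    using star_II_AutS_II star_II_involutive_iff
    unfolding stars_II_eq semi_hopf_star_def AutS_II_def by blast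
  show "?R \<subseteq> stars_II"
  proof
    fix \<Gamma> assume "\<Gamma> \<in> ?R"
    then obtain \<phi> where "\<phi> \<in> AutS_II" "\<Gamma> = I_op \<circ> \<phi>" and inv: "\<Gamma> \<circ> \<Gamma> = id"
      unfolding semi_hopf_star_def by blast
    then obtain \<alpha> \<beta> \<gamma> \<delta> where "\<Gamma> = star_II \<alpha> \<beta> \<gamma> \<delta>" using AutS_II_star by metis
    with inv show "\<Gamma> \<in> stars_II"
      unfolding stars_II_eq using star_II_involutive_iff by blast
  qed
qed

lemma semi_hopf_stars: "{\<Gamma>. semi_hopf_star \<Gamma>} = stars_I \<union> stars_II"
  unfolding stars_I_AutS_I stars_II_AutS_II using AutS_cases
  by (auto simp: semi_hopf_star_def)

lemma stars_I_star_op: "\<Gamma> \<in> stars_I \<Longrightarrow> star_op \<Gamma>"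
  unfolding stars_I_eq star_op_iff using star_I_involutive_iff star_I_antihom by blast

section \<open>Tensor products and the comultiplication\<close>

lemma tensor_eqI:
  assumes "semilinear \<sigma> T" "semilinear \<sigma> T'" "\<And>a b. T (a \<otimes> b) = T' (a \<otimes> b)"
  shows "T = T'"
proof
  fix x show "T x = T' x"
    by (induction x rule: tensor_induct)
      (simp_all add: semilinear_simps[OF assms(1)] semilinear_simps[OF assms(2)] assms(3))
qed

lemma tensor_zero_left: "(0 :: 'a::complex_algebra) \<otimes> (b :: 'b::complex_algebra) = 0"
  and tensor_zero_right: "(a :: 'a::complex_algebra) \<otimes> (0 :: 'b::complex_algebra) = 0"
  using tensor_scale_left[of 0 0 b] tensor_scale_right[of a 0 0] by simp_all

lemma tensor_minus_left: "(- a :: 'a::complex_algebra) \<otimes> (b :: 'b::complex_algebra) = - (a \<otimes> b)"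
  and tensor_minus_right: "(a :: 'a::complex_algebra) \<otimes> (- b :: 'b::complex_algebra) = - (a \<otimes> b)"
  using tensor_scale_left[of "-1" a b] tensor_scale_right[of a "-1" b]
  by (simp_all add: scaleC_minus_left)

lemma tensor_diff_left:
    "(a - a' :: 'a::complex_algebra) \<otimes> (b :: 'b::complex_algebra) = a \<otimes> b - a' \<otimes> b"
  and tensor_diff_right:
    "(a :: 'a::complex_algebra) \<otimes> (b - b' :: 'b::complex_algebra) = a \<otimes> b - a \<otimes> b'"
  using tensor_add_left[of a "- a'" b] tensor_add_right[of a b "- b'"]
  by (simp_all add: tensor_minus_left tensor_minus_right)

lemmas tensor_simps = tensor_add_left tensor_add_right tensor_scale_left tensor_scale_right
  tensor_zero_left tensor_zero_right tensor_minus_left tensor_minus_right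
  tensor_diff_left tensor_diff_right

text \<open>Since the complex numbers commute, multiplication is multiplicative on the monoid of
  pairs. It therefore extends to the monoid algebra and passes to the quotient.\<close>

lemma ex_tensor_multiplication:
  "\<exists>M :: (complex, complex) tensor \<Rightarrow> complex. semilinear id M \<and> (\<forall>a b. M (a \<otimes> b) = a * b)"
proof -
  define h :: "(complex, complex) tpair \<Rightarrow> complex" where "h m = (case m of TPair a b \<Rightarrow> a * b)" for m
  have hadd: "h (m + n) = h m * h n" for m n
    by (cases m; cases n) (simp add: h_def)
  note ext = mon_ext_add[OF field_endo_id] mon_ext_diff[OF field_endo_id]
    mon_ext_const_mult[OF field_endo_id] mon_ext_single[OF field_endo_id]
  have mult: "mon_ext id h (p * q) = mon_ext id h p * mon_ext id h q" for p q
    by (rule mon_ext_mult[OF field_endo_id hadd])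
  have rel: "mon_ext id h r = 0" if "r \<in> bilinearity_relations" for r
    using that unfolding bilinearity_relations_def
    by (auto simp: ext h_def scaleC_complex_def distrib_left distrib_right)
  have resp: "mon_ext id h x = mon_ext id h y" if "ideal_cong bilinearity_relations x y" for x y
    by (rule mon_ext_ideal_cong[OF field_endo_id _ rel that]) (use mult in blast)+
  define M where "M x = mon_ext id h (rep_tensor x)" for x
  have M: "M (abs_tensor p) = mon_ext id h p" for p
    unfolding M_def by (rule resp) (metis Quotient3_rep_abs Quotient3_tensor ideal_cong_refl)
  have abs: "\<exists>p. x = abs_tensor p" for x :: "(complex, complex) tensor"
    by (metis Quotient_tensor Quotient_abs_rep)
  have "semilinear id M"
    unfolding semilinear_def
  proof (intro conjI allI)
    fix x y :: "(complex, complex) tensor" and c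
    obtain p q where "x = abs_tensor p" "y = abs_tensor q" using abs by metis
    then show "M (x + y) = M x + M y" "M (c *\<^sub>C x) = id c *\<^sub>C M x"
      by (simp_all add: plus_tensor.abs_eq scaleC_tensor.abs_eq M ext)
  qed
  moreover have "M (a \<otimes> b) = a * b" for a b
    by (simp add: tensor_pure.abs_eq M ext h_def)
  ultimately show ?thesis by blast
qed

lemma ex_tensor_functional:
  assumes f: "semilinear id (f :: 'a::complex_algebra \<Rightarrow> complex)"
    and g: "semilinear id (g :: 'b::complex_algebra \<Rightarrow> complex)"
  shows "\<exists>L. semilinear id L \<and> (\<forall>a b. L (a \<otimes> b) = f a * g b)"
proof -
  obtain M :: "(complex, complex) tensor \<Rightarrow> complex"
    where M: "semilinear id M" "\<And>a b. M (a \<otimes> b) = a * b"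
    using ex_tensor_multiplication by blast
  note T = tensor_map_pure[OF field_endo_id f g]
  show ?thesis
    by (intro exI[of _ "M \<circ> tensor_map id f g"])
      (use T(1) in \<open>auto simp: semilinear_def M T semilinear_simps[OF M(1)]\<close>)
qed

text \<open>For component functions \<open>f\<close> and \<open>g\<close> this reads off one
  coefficient of a tensor with respect to the products of basis elements. It is how an equation
  between tensors is turned into equations between numbers.\<close>

definition coord_pairing ::
    "(coords \<Rightarrow> complex) \<Rightarrow> (coords \<Rightarrow> complex) \<Rightarrow> (H1i, H1i) tensor \<Rightarrow> complex" where
  "coord_pairing f g = (SOME L. semilinear id L \<and>
     (\<forall>a b. L (a \<otimes> b) = f (coordinates a) * g (coordinates b)))"

lemma coord_pairing:
  assumes "semilinear id f" "semilinear id g"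
  shows "semilinear id (coord_pairing f g)"
    "coord_pairing f g (a \<otimes> b) = f (coordinates a) * g (coordinates b)"
proof -
  have "semilinear id (\<lambda>x. f (coordinates x))" "semilinear id (\<lambda>x. g (coordinates x))"
    using assms by (simp_all add: semilinear_def)
  from someI_ex[OF ex_tensor_functional[OF this]]
  show "semilinear id (coord_pairing f g)"
    "coord_pairing f g (a \<otimes> b) = f (coordinates a) * g (coordinates b)"
    unfolding coord_pairing_def by blast+
qed

lemma coords_linear [simp]:
  "semilinear id c_e0" "semilinear id c_e1" "semilinear id c_E0" "semilinear id c_E1"
  "semilinear id c_F0" "semilinear id c_F1" "semilinear id c_C0" "semilinear id c_C1"
  by (simp_all add: semilinear_def coords_defs scaleC_complex_def)

lemmas coord_pairing_simps =
  coord_pairing(2) semilinear_simps[OF coord_pairing(1)] scaleC_complex_def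

section \<open>The comultiplication on the basis\<close>

lemmas comult_simps = algebra_homD[OF comult_spec(1)] comult_spec(2-4)

lemma comult_basis:
  "comult e0 = e0 \<otimes> e0 + e1 \<otimes> e1"
  "comult e1 = e0 \<otimes> e1 + e1 \<otimes> e0"
  "comult E0 = E0 \<otimes> e0 + e0 \<otimes> E0 + E1 \<otimes> e1 - e1 \<otimes> E1"
  "comult E1 = E0 \<otimes> e1 + e0 \<otimes> E1 + E1 \<otimes> e0 - e1 \<otimes> E0"
  "comult F0 = F0 \<otimes> e0 + e0 \<otimes> F0 - F1 \<otimes> e1 + e1 \<otimes> F1"
  "comult F1 = - (F0 \<otimes> e1) + e0 \<otimes> F1 + F1 \<otimes> e0 + e1 \<otimes> F0"
  "comult C0 = C0 \<otimes> e0 + E0 \<otimes> F0 - F0 \<otimes> E0 + e0 \<otimes> C0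
      - C1 \<otimes> e1 + E1 \<otimes> F1 - F1 \<otimes> E1 - e1 \<otimes> C1"
  "comult C1 = - (C0 \<otimes> e1) + E0 \<otimes> F1 + F0 \<otimes> E1 + e0 \<otimes> C1
      + C1 \<otimes> e0 + E1 \<otimes> F0 + F1 \<otimes> E0 - e1 \<otimes> C0"
proof -
  have half: "(1/2) *\<^sub>C (x + x) = x" for x :: "(H1i, H1i) tensor"
    by (simp add: scaleC_add_right flip: scaleC_add_left)
  have e: "comult e0 = (1/2) *\<^sub>C (1 \<otimes> 1 + K \<otimes> K)" "comult e1 = (1/2) *\<^sub>C (1 \<otimes> 1 - K \<otimes> K)"
    by (simp_all only: e0_def e1_def comult_simps tensor_one)
  \<comment> \<open>With \<open>1 = e0 + e1\<close> and \<open>K = e0 - e1\<close>, the mixed terms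
    cancel in the sum and the pure ones in the difference; what remains appears twice and absorbs
    the factor 1/2.\<close>
  have "1 \<otimes> 1 + K \<otimes> K = (e0 \<otimes> e0 + e1 \<otimes> e1) + (e0 \<otimes> e0 + e1 \<otimes> e1)"
    "1 \<otimes> 1 - K \<otimes> K = (e0 \<otimes> e1 + e1 \<otimes> e0) + (e0 \<otimes> e1 + e1 \<otimes> e0)"
    unfolding KEF_basis(1,2) by (simp_all add: tensor_simps)
  then show e0: "comult e0 = e0 \<otimes> e0 + e1 \<otimes> e1" and e1: "comult e1 = e0 \<otimes> e1 + e1 \<otimes> e0"
    unfolding e by (simp_all only: half)
  note mult = distrib_left distrib_right left_diff_distrib right_diff_distrib tensor_mult basis_mult
    tensor_simps
  have E: "comult E0 = comult e0 * comult E" "comult E1 = comult e1 * comult E"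
    "comult F0 = comult e0 * comult F" "comult F1 = comult e1 * comult F"
    "comult C0 = comult E0 * comult F" "comult C1 = comult E1 * comult F"
    by (simp_all add: E0_def E1_def F0_def F1_def C0_def C1_def comult_simps mult.assoc)
  show E0: "comult E0 = E0 \<otimes> e0 + e0 \<otimes> E0 + E1 \<otimes> e1 - e1 \<otimes> E1"
    and E1: "comult E1 = E0 \<otimes> e1 + e0 \<otimes> E1 + E1 \<otimes> e0 - e1 \<otimes> E0"
    and "comult F0 = F0 \<otimes> e0 + e0 \<otimes> F0 - F1 \<otimes> e1 + e1 \<otimes> F1"
    and "comult F1 = - (F0 \<otimes> e1) + e0 \<otimes> F1 + F1 \<otimes> e0 + e1 \<otimes> F0"
    unfolding E e0 e1 comult_spec by (simp_all add: mult)
  show "comult C0 = C0 \<otimes> e0 + E0 \<otimes> F0 - F0 \<otimes> E0 + e0 \<otimes> C0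
      - C1 \<otimes> e1 + E1 \<otimes> F1 - F1 \<otimes> E1 - e1 \<otimes> C1"
    and "comult C1 = - (C0 \<otimes> e1) + E0 \<otimes> F1 + F0 \<otimes> E1 + e0 \<otimes> C1
      + C1 \<otimes> e0 + E1 \<otimes> F0 + F1 \<otimes> E0 - e1 \<otimes> C0"
    unfolding E(5,6) E0 E1 comult_spec by (simp_all add: mult)
qed

lemma comult_expand:
  "comult x = (let v = coordinates x in c_e0 v *\<^sub>C comult e0 + c_e1 v *\<^sub>C comult e1 +
     c_E0 v *\<^sub>C comult E0 + c_E1 v *\<^sub>C comult E1 + c_F0 v *\<^sub>C comult F0 + c_F1 v *\<^sub>C comult F1 +
     c_C0 v *\<^sub>C comult C0 + c_C1 v *\<^sub>C comult C1)"
proof -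
  have "comult x = comult (of_coords (coordinates x))" by simp
  then show ?thesis by (simp only: of_coords_def comult_simps Let_def)
qed

section \<open>Grouplike and skew-primitive elements\<close>

lemmas coord_pairing_comult =
  comult_basis Let_def coord_pairing_simps

text \<open>For each of the six nilpotent basis elements \<open>y\<close>, the term
  \<open>y \<otimes> y\<close> occurs in no comultiplication, so the square of the corresponding
  coefficient vanishes. The term \<open>e0 \<otimes> e0\<close> and the square of \<open>x\<close>
  leave only \<open>1\<close> and \<open>K\<close>.\<close>

lemma grouplike_eq_K:
  assumes "comult x = x \<otimes> x" "x * x = 1" "x \<noteq> 1"
  shows "x = K"
proof -
  let ?v = "coordinates x"
  note eq = arg_cong[OF assms(1)[unfolded comult_expand[of x]], of "coord_pairing f g" for f g]
  have "c_E0 ?v = 0" "c_E1 ?v = 0" "c_F0 ?v = 0" "c_F1 ?v = 0" "c_C0 ?v = 0" "c_C1 ?v = 0"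
    using eq[of c_E0 c_E0] eq[of c_E1 c_E1] eq[of c_F0 c_F0] eq[of c_F1 c_F1] eq[of c_C0 c_C0]
      eq[of c_C1 c_C1]
    by (simp_all add: coord_pairing_comult)
  moreover have "c_e0 ?v = c_e0 ?v * c_e0 ?v"
    using eq[of c_e0 c_e0] by (simp add: coord_pairing_comult)
  moreover have "c_e0 ?v * c_e0 ?v = 1" "c_e1 ?v * c_e1 ?v = 1"
    using assms(2) by (simp_all add: H1i_arith)
  moreover from this have "c_e1 ?v = 1 \<or> c_e1 ?v = -1"
    using square_eq_1_iff by blast
  moreover have "?v \<noteq> 1" using assms(3) by (simp add: H1i_eq_iff)
  ultimately show ?thesis by (cases ?v) (auto simp: H1i_arith)
qed

text \<open>The condition on the square excludes the multiples of \<open>1 - K\<close>, which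
  satisfy the same comultiplication rule.\<close>

lemma skew_primitive_E:
  assumes "comult x = x \<otimes> 1 + K \<otimes> x" "x * x = 0"
  obtains \<alpha> \<beta> where "x = \<alpha> *\<^sub>C E - \<beta> *\<^sub>C (K * F)"
proof
  let ?v = "coordinates x"
  note eq = arg_cong[OF assms(1)[unfolded comult_expand[of x]], of "coord_pairing f g" for f g]
  have "c_e0 ?v = 0" "c_e1 ?v = 0"
    using assms(2) by (simp_all add: H1i_arith)
  \<comment> \<open>The term \<open>E0 \<otimes> e1\<close> occurs only in \<open>comult E1\<close>
    on the left and in \<open>x \<otimes> 1\<close> on the right. The remaining pairs are chosen in
    the same way, to isolate one unknown on the left.\<close>
  moreover have "c_E1 ?v = c_E0 ?v"
    using eq[of c_E0 c_e1] by (simp add: coord_pairing_comult one_coords_def)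
  moreover have "c_F0 ?v = - c_F1 ?v"
    using eq[of c_F0 c_e1] by (simp add: coord_pairing_comult one_coords_def)
  moreover have "c_C0 ?v = 0" "c_C1 ?v = 0"
    using eq[of c_E0 c_F0] eq[of c_E0 c_F1] by (simp_all add: coord_pairing_comult one_coords_def)
  ultimately show "x = c_E0 ?v *\<^sub>C E - c_F1 ?v *\<^sub>C (K * F)"
    by (cases ?v) (simp add: H1i_arith)
qed

lemma skew_primitive_F:
  assumes "comult x = x \<otimes> K + 1 \<otimes> x" "x * x = 0"
  obtains \<gamma> \<delta> where "x = \<delta> *\<^sub>C F - \<gamma> *\<^sub>C (K * E)"
proof
  let ?v = "coordinates x"
  note eq = arg_cong[OF assms(1)[unfolded comult_expand[of x]], of "coord_pairing f g" for f g]
  have "c_e0 ?v = 0" "c_e1 ?v = 0"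
    using assms(2) by (simp_all add: H1i_arith)
  moreover have "c_E1 ?v = - c_E0 ?v"
    using eq[of c_E0 c_e1] by (simp add: coord_pairing_comult one_coords_def)
  moreover have "c_F1 ?v = c_F0 ?v"
    using eq[of c_F0 c_e1] by (simp add: coord_pairing_comult one_coords_def)
  moreover have "c_C0 ?v = 0" "c_C1 ?v = 0"
    using eq[of c_E0 c_F0] eq[of c_E0 c_F1] by (simp_all add: coord_pairing_comult one_coords_def)
  ultimately show "x = c_F0 ?v *\<^sub>C F - (- c_E0 ?v) *\<^sub>C (K * E)"
    by (cases ?v) (simp add: H1i_arith)
qed

section \<open>Hopf \<open>*\<close>-operations\<close>

lemma tensor_map_cnj_antihom:
  fixes f :: "'a::complex_algebra \<Rightarrow> 'c::complex_algebra"
    and g :: "'b::complex_algebra \<Rightarrow> 'd::complex_algebra"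
  assumes f: "cnj_antihom f" and g: "cnj_antihom g"
  shows "cnj_antihom (tensor_map cnj f g)"
proof -
  have "semilinear cnj f" "semilinear cnj g" using f g by (auto simp: cnj_antihom_def)
  note T = tensor_map_pure[OF field_endo_cnj this]
  note lin = semilinear_simps[OF T(1)]
  have "tensor_map cnj f g (x * y) = tensor_map cnj f g y * tensor_map cnj f g x" for x y
  proof (induction x rule: tensor_induct)
    case (pure a b)
    show ?case
      by (induction y rule: tensor_induct)
        (simp_all add: lin T tensor_mult cnj_antihomD[OF f] cnj_antihomD[OF g] distrib_left
          distrib_right scaleC_mult_left scaleC_mult_right)
  qed (simp_all add: lin distrib_left distrib_right scaleC_mult_left scaleC_mult_right)
  then show ?thesis
    using T(1) by (simp add: cnj_antihom_def antimultiplicative_def tensor_one T cnj_antihomD[OF f]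
        cnj_antihomD[OF g])
qed

text \<open>Both sides of the compatibility condition are antilinear antihomomorphisms into the
  tensor product, so they agree once they agree on the generators.\<close>

lemma comult_compatible_iff:
  assumes \<Gamma>: "cnj_antihom \<Gamma>"
  shows "comult_compatible \<Gamma> \<longleftrightarrow> comult (\<Gamma> K) = \<Gamma> K \<otimes> \<Gamma> K \<and>
    comult (\<Gamma> E) = \<Gamma> E \<otimes> 1 + \<Gamma> K \<otimes> \<Gamma> E \<and> comult (\<Gamma> F) = \<Gamma> F \<otimes> \<Gamma> K + 1 \<otimes> \<Gamma> F"
proof -
  have "semilinear cnj \<Gamma>" using \<Gamma> by (simp add: cnj_antihom_def)
  note T = tensor_map_pure(2)[OF field_endo_cnj this this]
  note hom = tensor_map_cnj_antihom[OF \<Gamma> \<Gamma>]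
  let ?L = "comult \<circ> \<Gamma>" and ?R = "tensor_map cnj \<Gamma> \<Gamma> \<circ> comult"
  have "cnj_antihom ?L" "cnj_antihom ?R"
    using \<Gamma> hom comult_spec(1)
    by (simp_all add: cnj_antihom_def antimultiplicative_def semilinear_def algebra_hom_def)
  then have "?L = ?R \<longleftrightarrow> ?L K = ?R K \<and> ?L E = ?R E \<and> ?L F = ?R F"
    using cnj_antihom_eqI by metis
  then show ?thesis
    by (simp add: comult_compatible_def fun_eq_iff comult_spec cnj_antihomD[OF hom] T
        cnj_antihomD[OF \<Gamma>])
qed

lemma stars_I_comult_compatible: "\<Gamma> \<in> stars_I \<Longrightarrow> comult_compatible \<Gamma>"
  unfolding stars_I_eq
  by (auto simp: comult_compatible_iff[OF star_I_antihom] star_I_gens comult_simps tensor_mult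
      H1i_mult_simps distrib_left tensor_simps scaleC_add_right scaleC_diff_right)

lemma stars_II_not_comult_compatible:
  assumes "\<Gamma> \<in> stars_II"
  shows "\<not> comult_compatible \<Gamma>"
proof
  assume "comult_compatible \<Gamma>"
  then have eq: "- (K \<otimes> K) = K \<otimes> K"
    using assms unfolding stars_II_eq
    by (auto simp: comult_compatible_iff[OF star_II_antihom] star_II_gens comult_simps tensor_simps)
  \<comment> \<open>The coefficient of \<open>e0 \<otimes> e0\<close> is -1 on the left and 1 on the
    right.\<close>
  from arg_cong[OF eq, of "coord_pairing c_e0 c_e0"] show False
    by (simp add: coord_pairing_simps)
qed

lemma hopf_stars: "stars_I = {\<Gamma>. hopf_star \<Gamma>}"
proof
  show "stars_I \<subseteq> {\<Gamma>. hopf_star \<Gamma>}"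
    using stars_I_star_op stars_I_comult_compatible by (auto simp: hopf_star_def)
  show "{\<Gamma>. hopf_star \<Gamma>} \<subseteq> stars_I"
  proof
    fix \<Gamma> assume "\<Gamma> \<in> {\<Gamma>. hopf_star \<Gamma>}"
    then have \<Gamma>: "cnj_antihom \<Gamma>" "\<Gamma> \<circ> \<Gamma> = id" "comult_compatible \<Gamma>"
      by (simp_all add: hopf_star_def star_op_iff)
    have compat: "comult (\<Gamma> K) = \<Gamma> K \<otimes> \<Gamma> K" "comult (\<Gamma> E) = \<Gamma> E \<otimes> 1 + \<Gamma> K \<otimes> \<Gamma> E"
      "comult (\<Gamma> F) = \<Gamma> F \<otimes> \<Gamma> K + 1 \<otimes> \<Gamma> F"
      using \<Gamma>(3) by (simp_all add: comult_compatible_iff[OF \<Gamma>(1)])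
    have sq: "\<Gamma> x * \<Gamma> x = \<Gamma> (x * x)" for x by (simp add: cnj_antihomD[OF \<Gamma>(1)])
    have squares: "\<Gamma> K * \<Gamma> K = 1" "\<Gamma> E * \<Gamma> E = 0" "\<Gamma> F * \<Gamma> F = 0"
      unfolding sq H1i_mult_simps by (simp_all add: cnj_antihomD[OF \<Gamma>(1)])
    \<comment> \<open>An involution is injective; this excludes the grouplike element
      \<open>1\<close> as the image of \<open>K\<close>.\<close>
    have "\<Gamma> K \<noteq> \<Gamma> 1"
    proof
      assume "\<Gamma> K = \<Gamma> 1"
      then have "(\<Gamma> \<circ> \<Gamma>) K = (\<Gamma> \<circ> \<Gamma>) 1" by simp
      then show False unfolding \<Gamma>(2) by (simp add: H1i_arith)
    qed
    then have K: "\<Gamma> K = K"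
      using grouplike_eq_K[OF compat(1) squares(1)] by (simp add: cnj_antihomD[OF \<Gamma>(1)])
    obtain \<alpha> \<beta> where E: "\<Gamma> E = \<alpha> *\<^sub>C E - \<beta> *\<^sub>C (K * F)"
      using skew_primitive_E[OF compat(2)[unfolded K] squares(2)] .
    obtain \<gamma> \<delta> where F: "\<Gamma> F = \<delta> *\<^sub>C F - \<gamma> *\<^sub>C (K * E)"
      using skew_primitive_F[OF compat(3)[unfolded K] squares(3)] .
    have "\<Gamma> = star_I \<alpha> \<beta> \<gamma> \<delta>" using \<Gamma>(1) K E F by (rule star_I_eqI)
    with \<Gamma>(2) show "\<Gamma> \<in> stars_I"
      unfolding stars_I_eq using star_I_involutive_iff by blast
  qed
qed

text \<open>The homomorphism leading from \<Gamma> to \<Gamma>' is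
  \<open>\<Gamma> \<circ> \<Gamma>'\<close>. Two antilinear antihomomorphisms compose to a linear
  homomorphism, and compatibility with the comultiplication is inherited from both factors.\<close>

lemma stars_I_orbit:
  assumes \<Gamma>: "\<Gamma> \<in> stars_I" and \<Gamma>': "\<Gamma>' \<in> stars_I"
  shows "\<Gamma>' \<in> right_orbit \<Gamma>"
proof -
  have st: "cnj_antihom \<Gamma>" "\<Gamma> \<circ> \<Gamma> = id" "cnj_antihom \<Gamma>'" "\<Gamma>' \<circ> \<Gamma>' = id"
    using \<Gamma> \<Gamma>' stars_I_star_op by (auto simp: star_op_iff)
  let ?\<phi> = "\<Gamma> \<circ> \<Gamma>'"
  have hom: "algebra_hom ?\<phi>" using st(1,3) by (rule cnj_antihom_comp)
  have lin: "semilinear cnj \<Gamma>" "semilinear cnj \<Gamma>'" "semilinear id ?\<phi>"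
    using st(1,3) hom by (simp_all add: cnj_antihom_def algebra_hom_def)
  have "tensor_map id ?\<phi> ?\<phi> = tensor_map cnj \<Gamma> \<Gamma> \<circ> tensor_map cnj \<Gamma>' \<Gamma>'"
    using tensor_map_pure(1)[OF field_endo_cnj lin(1,1)]
      tensor_map_pure(1)[OF field_endo_cnj lin(2,2)]
      tensor_map_pure(1)[OF field_endo_id lin(3,3)]
    by (intro tensor_eqI[of id])
      (simp_all add: tensor_map_pure(2)[OF field_endo_cnj lin(1,1)]
        tensor_map_pure(2)[OF field_endo_cnj lin(2,2)]
        tensor_map_pure(2)[OF field_endo_id lin(3,3)],
        simp add: semilinear_def)
  then have "comult (?\<phi> a) = tensor_map id ?\<phi> ?\<phi> (comult a)" for a
    using stars_I_comult_compatible[OF \<Gamma>] stars_I_comult_compatible[OF \<Gamma>']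
    by (simp add: comult_compatible_def)
  moreover have "counit \<circ> ?\<phi> = counit"
  proof -
    obtain \<alpha> \<beta> \<gamma> \<delta> \<alpha>' \<beta>' \<gamma>' \<delta>' where "\<Gamma> = star_I \<alpha> \<beta> \<gamma> \<delta>" "\<Gamma>' = star_I \<alpha>' \<beta>' \<gamma>' \<delta>'"
      using \<Gamma> \<Gamma>' unfolding stars_I_eq by blast
    then show ?thesis
      by (intro algebra_hom_eqI algebra_hom_comp hom counit_spec(1))
        (simp_all add: star_I_simps counit_spec algebra_homD[OF counit_spec(1)])
  qed
  ultimately have "hopf_hom ?\<phi>"
    using hom by (simp add: hopf_hom_def fun_eq_iff)
  moreover have "bij ?\<phi>" using st by (intro bij_comp involutory_bij)
  moreover have "\<Gamma>' = \<Gamma> \<circ> ?\<phi>" using st(2) by (simp add: fun_eq_iff)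
  ultimately show ?thesis unfolding right_orbit_def by blast
qed

section \<open>The four-parameter family of type I\<close>

lemma family_I_eq:
  assumes "0 < 1 + b * c"
  shows "family_I (b, c, \<phi>, \<psi>) = star_I (sqrt (1 + b * c) * cis \<phi>) (b * cis ((\<phi> + \<psi>) / 2))
      (c * cis ((\<phi> + \<psi>) / 2)) (sqrt (1 + b * c) * cis \<psi>)" (is "_ = star_I ?\<alpha> ?\<beta> ?\<gamma> ?\<delta>")
    and "involutive_coeffs (sqrt (1 + b * c) * cis \<phi>) (b * cis ((\<phi> + \<psi>) / 2))
      (c * cis ((\<phi> + \<psi>) / 2)) (sqrt (1 + b * c) * cis \<psi>)"
proof -
  let ?R = "\<exists>a r u \<phi>' \<psi>'. 0 \<le> a \<and> a\<^sup>2 - r * u = 1 \<and> ?\<alpha> = of_real a * cis \<phi>' \<and>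
      ?\<beta> = of_real r * cis ((\<phi>' + \<psi>') / 2) \<and> ?\<gamma> = of_real u * cis ((\<phi>' + \<psi>') / 2) \<and>
      ?\<delta> = of_real a * cis \<psi>'"
  have sq: "(sqrt (1 + b * c))\<^sup>2 - b * c = 1" using assms by simp
  moreover have "0 \<le> sqrt (1 + b * c)" using assms by simp
  ultimately have ?R by blast
  then show "involutive_coeffs ?\<alpha> ?\<beta> ?\<gamma> ?\<delta>" by (simp only: involutive_coeffs_iff)
  have "?\<alpha> * ?\<delta> - ?\<beta> * ?\<gamma> =
      of_real ((sqrt (1 + b * c))\<^sup>2 - b * c) * cis (\<phi> + \<psi>)"
  proof -
    have "cis ((\<phi> + \<psi>) / 2) * cis ((\<phi> + \<psi>) / 2) = cis (\<phi> + \<psi>)" "cis \<phi> * cis \<psi> = cis (\<phi> + \<psi>)"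
      by (simp_all add: cis_mult)
    moreover have "?\<alpha> * ?\<delta> - ?\<beta> * ?\<gamma> = of_real ((sqrt (1 + b * c))\<^sup>2) * (cis \<phi> * cis \<psi>) -
        of_real (b * c) * (cis ((\<phi> + \<psi>) / 2) * cis ((\<phi> + \<psi>) / 2))"
      unfolding power2_eq_square of_real_mult by (simp only: mult_ac)
    ultimately show ?thesis by (simp only: of_real_diff left_diff_distrib)
  qed
  then have mu: "cis (\<phi> + \<psi>) = ?\<alpha> * ?\<delta> - ?\<beta> * ?\<gamma>" unfolding sq by simp
  show "family_I (b, c, \<phi>, \<psi>) = star_I ?\<alpha> ?\<beta> ?\<gamma> ?\<delta>"
    unfolding family_I_def prod.case mu table_I_iff by simp
qed

lemma polar_unique:
  assumes "of_real a * cis \<phi> = complex_of_real a' * cis \<phi>'" "0 < a" "0 < a'"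
    "\<phi> \<in> {0..<2 * pi}" "\<phi>' \<in> {0..<2 * pi}"
  shows "\<phi> = \<phi>'"
proof -
  have "cmod (of_real a * cis \<phi>) = cmod (of_real a' * cis \<phi>')" using assms(1) by simp
  then have "a = a'" using assms(2,3) by (simp add: norm_mult)
  then have "cis \<phi> = cis \<phi>'" using assms(1,2) by simp
  then have "cis (\<phi> - \<phi>') = 1" by (simp flip: cis_divide)
  then have "cos (\<phi> - \<phi>') = 1" by (simp add: complex_eq_iff)
  then obtain k :: int where k: "\<phi> - \<phi>' = of_int k * 2 * pi"
    unfolding cos_one_2pi_int by blast
  have "\<bar>\<phi> - \<phi>'\<bar> < 2 * pi" using assms(4,5) by auto
  then have "\<bar>of_int k :: real\<bar> < 1" unfolding k by (simp add: abs_mult)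
  then have "k = 0" by linarith
  then show "\<phi> = \<phi>'" using k by simp
qed

lemma cis_reduce:
  obtains \<phi>' k where "\<phi>' \<in> {0..<2 * pi}" "\<phi> = \<phi>' + 2 * pi * of_int k"
proof
  let ?k = "\<lfloor>\<phi> / (2 * pi)\<rfloor>"
  show "\<phi> - 2 * pi * of_int ?k \<in> {0..<2 * pi}"
    using floor_divide_lower[of "2 * pi" \<phi>] floor_divide_upper[of "2 * pi" \<phi>]
    by (simp add: algebra_simps)
  show "\<phi> = \<phi> - 2 * pi * of_int ?k + 2 * pi * of_int ?k" by simp
qed

lemma family_I_bij:
  "bij_betw family_I {(b, c, \<phi>, \<psi>). 0 < 1 + b * c \<and> \<phi> \<in> {0..<2 * pi} \<and> \<psi> \<in> {0..<2 * pi}}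
     {\<Gamma> \<in> stars_I. \<forall>\<beta>. \<Gamma> E0 \<noteq> \<beta> *\<^sub>C F1}" (is "bij_betw _ ?D ?S")
  unfolding bij_betw_def
proof
  \<comment> \<open>The condition in the target set says that \<alpha> is not zero. This is what
    makes the phases recoverable from \<alpha> and \<delta>.\<close>
  have E0: "(\<forall>\<beta>'. star_I \<alpha> \<beta> \<gamma> \<delta> E0 \<noteq> \<beta>' *\<^sub>C F1) \<longleftrightarrow> \<alpha> \<noteq> 0" for \<alpha> \<beta> \<gamma> \<delta>
    using table_star_I[of \<alpha> \<beta> \<gamma> \<delta>] by (auto simp: table_I_def H1i_arith)
  show "inj_on family_I ?D"
  proof (rule inj_onI)
    fix x y assume "x \<in> ?D" "y \<in> ?D" and xy: "family_I x = family_I y"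
    then obtain b c \<phi> \<psi> b' c' \<phi>' \<psi>'
      where x: "x = (b, c, \<phi>, \<psi>)" and y: "y = (b', c', \<phi>', \<psi>')"
        and *: "0 < 1 + b * c" "\<phi> \<in> {0..<2 * pi}" "\<psi> \<in> {0..<2 * pi}"
          "0 < 1 + b' * c'" "\<phi>' \<in> {0..<2 * pi}" "\<psi>' \<in> {0..<2 * pi}"
      by blast
    note eqs = xy[unfolded x y family_I_eq(1)[OF *(1)] family_I_eq(1)[OF *(4)] star_I_inject]
    have pos: "0 < sqrt (1 + b * c)" "0 < sqrt (1 + b' * c')" using * by simp_all
    have "\<phi> = \<phi>'" "\<psi> = \<psi>'"
      using polar_unique[OF _ pos] eqs *(2,3,5,6) by blast+
    then show "x = y" using eqs by (simp add: x y)
  qed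
  show "family_I ` ?D = ?S"
  proof (intro equalityI subsetI)
    fix \<Gamma> assume "\<Gamma> \<in> family_I ` ?D"
    then obtain b c \<phi> \<psi> :: real where pos: "0 < 1 + b * c" and \<Gamma>: "\<Gamma> = family_I (b, c, \<phi>, \<psi>)"
      by auto
    have "\<Gamma> \<in> stars_I"
      unfolding \<Gamma> stars_I_eq family_I_eq(1)[OF pos] using family_I_eq(2)[OF pos] by blast
    moreover have "\<forall>\<beta>. \<Gamma> E0 \<noteq> \<beta> *\<^sub>C F1"
      unfolding \<Gamma> family_I_eq(1)[OF pos] E0 using pos by simp
    ultimately show "\<Gamma> \<in> ?S" by simp
  next
    fix \<Gamma> assume "\<Gamma> \<in> ?S"
    then obtain \<alpha> \<beta> \<gamma> \<delta> where \<Gamma>: "\<Gamma> = star_I \<alpha> \<beta> \<gamma> \<delta>" and inv: "involutive_coeffs \<alpha> \<beta> \<gamma> \<delta>"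
      and nz: "\<forall>\<beta>. \<Gamma> E0 \<noteq> \<beta> *\<^sub>C F1"
      unfolding stars_I_eq by blast
    have "\<alpha> \<noteq> 0" using nz unfolding \<Gamma> E0 .
    obtain a r u \<phi> \<psi> where *: "0 \<le> a" "a\<^sup>2 - r * u = 1" "\<alpha> = of_real a * cis \<phi>"
      "\<beta> = of_real r * cis ((\<phi> + \<psi>) / 2)" "\<gamma> = of_real u * cis ((\<phi> + \<psi>) / 2)"
      "\<delta> = of_real a * cis \<psi>"
      using inv unfolding involutive_coeffs_iff by blast
    obtain \<phi>' k where \<phi>': "\<phi>' \<in> {0..<2 * pi}" "\<phi> = \<phi>' + 2 * pi * of_int k"
      by (rule cis_reduce)
    obtain \<psi>' l where \<psi>': "\<psi>' \<in> {0..<2 * pi}" "\<psi> = \<psi>' + 2 * pi * of_int l"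
      by (rule cis_reduce)
    \<comment> \<open>Reducing both phases modulo \<open>2 * pi\<close> moves their half sum by
      \<open>pi * (k + l)\<close>, which multiplies its \<open>cis\<close> by \<open>s\<close>. The
      sign is absorbed into \<open>r\<close> and \<open>u\<close>, and their product does not
      change.\<close>
    define s :: real where "s = (if even (k + l) then 1 else -1)"
    have "cis ((\<phi> + \<psi>) / 2) = cis ((\<phi>' + \<psi>') / 2) * cis (pi * of_int (k + l))"
      unfolding \<phi>' \<psi>' cis_mult by (rule arg_cong[of _ _ cis]) (simp add: field_simps)
    also have "cis (pi * of_int (k + l)) = of_real s"
      by (simp only: complex_eq_iff cis.sel cos_npi_int sin_npi_int) (simp add: s_def)
    finally have half: "cis ((\<phi> + \<psi>) / 2) = of_real s * cis ((\<phi>' + \<psi>') / 2)"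
      by (simp add: mult.commute)
    have per: "cis \<phi> = cis \<phi>'" "cis \<psi> = cis \<psi>'"
      by (simp_all add: \<phi>'(2) \<psi>'(2) cis_multiple_2pi flip: cis_mult)
    have "s * s = 1" by (simp add: s_def)
    then have "1 + (r * s) * (u * s) = a\<^sup>2" using *(2) by (simp add: algebra_simps)
    moreover have "0 < a" using *(1,3) \<open>\<alpha> \<noteq> 0\<close> by (cases "a = 0") auto
    ultimately have pos: "0 < 1 + (r * s) * (u * s)" and a: "sqrt (1 + (r * s) * (u * s)) = a"
      by simp_all
    have "\<Gamma> = family_I (r * s, u * s, \<phi>', \<psi>')"
      unfolding \<Gamma> family_I_eq(1)[OF pos] a using *(3-) by (simp add: half per mult_ac)
    with pos \<phi>'(1) \<psi>'(1) show "\<Gamma> \<in> family_I ` ?D" by blast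
  qed
qed

theorem proposition5p5:
  shows
    "{\<Gamma>. semi_hopf_star \<Gamma>} = stars_I \<union> stars_II \<and>
     stars_I = {\<Gamma>. semi_hopf_star \<Gamma> \<and> (\<exists>\<phi>\<in>AutS_I. \<Gamma> = I_op \<circ> \<phi>)} \<and>
     stars_II = {\<Gamma>. semi_hopf_star \<Gamma> \<and> (\<exists>\<phi>\<in>AutS_II. \<Gamma> = I_op \<circ> \<phi>)} \<and>
     (\<forall>a b c \<phi> \<psi> s t \<alpha> \<beta> \<gamma> \<delta> \<mu>. coeffs_I a b c \<phi> \<psi> s t \<alpha> \<beta> \<gamma> \<delta> \<mu> \<longrightarrow>
        \<mu> = cis (\<phi> + \<psi>) \<and> (\<exists>!\<Gamma>. semilinear cnj \<Gamma> \<and> table_I \<alpha> \<beta> \<gamma> \<delta> \<mu> \<Gamma>)) \<and>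
     (\<forall>a b c \<phi> \<psi> s t \<alpha> \<beta> \<gamma> \<delta> \<mu>. coeffs_II a b c \<phi> \<psi> s t \<alpha> \<beta> \<gamma> \<delta> \<mu> \<longrightarrow>
        \<mu> = - cis (\<phi> + \<psi>) \<and> (\<exists>!\<Gamma>. semilinear cnj \<Gamma> \<and> table_II \<alpha> \<beta> \<gamma> \<delta> \<mu> \<Gamma>)) \<and>
     stars_I = {\<Gamma>. hopf_star \<Gamma>} \<and>
     (\<forall>\<Gamma>\<in>stars_I. comult_compatible \<Gamma>) \<and>
     (\<forall>\<Gamma>\<in>stars_II. \<not> comult_compatible \<Gamma>) \<and>
     bij_betw family_I
       {(b, c, \<phi>, \<psi>). 0 < 1 + b * c \<and> \<phi> \<in> {0..<2 * pi} \<and> \<psi> \<in> {0..<2 * pi}}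
       {\<Gamma> \<in> stars_I. \<forall>\<beta>. \<Gamma> E0 \<noteq> \<beta> *\<^sub>C F1} \<and>
     (\<forall>\<Gamma>\<in>stars_I. \<forall>\<Gamma>'\<in>stars_I. \<Gamma>' \<in> right_orbit \<Gamma>) \<and>
     (\<exists>a b c \<phi> \<psi> s t. coeffs_I a b c \<phi> \<psi> s t 1 0 0 1 1) \<and>
     I_op \<in> stars_I \<and> table_I 1 0 0 1 1 I_op \<and>
     (\<exists>a b c \<phi> \<psi> s t. coeffs_I a b c \<phi> \<psi> s t 0 (- \<i>) \<i> 0 (- 1)) \<and>
     (\<exists>\<Gamma>\<in>stars_I. table_I 0 (- \<i>) \<i> 0 (- 1) \<Gamma> \<and>
        \<Gamma> e0 = e0 \<and> \<Gamma> E0 = (- \<i>) *\<^sub>C F1 \<and> \<Gamma> F0 = \<i> *\<^sub>C E1 \<and> \<Gamma> C0 = - C0 \<and>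
        \<Gamma> e1 = e1 \<and> \<Gamma> E1 = \<i> *\<^sub>C F0 \<and> \<Gamma> F1 = (- \<i>) *\<^sub>C E0 \<and> \<Gamma> C1 = - C1 \<and>
        \<Gamma> K = K \<and> \<Gamma> E = \<i> *\<^sub>C (K * F) \<and> \<Gamma> F = \<i> *\<^sub>C (E * Kinv))"
proof -
  have I: "\<exists>!\<Gamma>. semilinear cnj \<Gamma> \<and> table_I \<alpha> \<beta> \<gamma> \<delta> \<mu> \<Gamma>"
    if "coeffs_I a b c \<phi> \<psi> s t \<alpha> \<beta> \<gamma> \<delta> \<mu>" for a b c \<phi> \<psi> s t \<alpha> \<beta> \<gamma> \<delta> \<mu>
  proof -
    have \<mu>: "\<mu> = \<alpha> * \<delta> - \<beta> * \<gamma>" using that by (simp add: coeffs_I_def)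
    show ?thesis unfolding \<mu> table_I_iff by simp
  qed
  have II: "\<mu> = - cis (\<phi> + \<psi>)" "\<exists>!\<Gamma>. semilinear cnj \<Gamma> \<and> table_II \<alpha> \<beta> \<gamma> \<delta> \<mu> \<Gamma>"
    if "coeffs_II a b c \<phi> \<psi> s t \<alpha> \<beta> \<gamma> \<delta> \<mu>" for a b c \<phi> \<psi> s t \<alpha> \<beta> \<gamma> \<delta> \<mu>
  proof -
    show "\<mu> = - cis (\<phi> + \<psi>)"
      using coeffs_I_mu[OF that[unfolded coeffs_II_eq]] by (metis minus_minus)
    have \<mu>: "\<mu> = - (\<alpha> * \<delta> - \<beta> * \<gamma>)" using that by (simp add: coeffs_II_def)
    show "\<exists>!\<Gamma>. semilinear cnj \<Gamma> \<and> table_II \<alpha> \<beta> \<gamma> \<delta> \<mu> \<Gamma>"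
      unfolding \<mu> table_II_iff by simp
  qed
  have "coeffs_I 1 0 0 0 0 1 1 1 0 0 1 1"
    by (simp add: coeffs_I_def)
  then have one: "\<exists>a b c \<phi> \<psi> s t. coeffs_I a b c \<phi> \<psi> s t 1 0 0 1 1" by blast
  \<comment> \<open>With both phases \<open>pi / 2\<close> the half sum has \<open>cis\<close> equal
    to \<open>\<i>\<close>. The signs of \<beta> and \<gamma> are opposite, so the constraint holds
    with \<open>a = 0\<close>.\<close>
  have "coeffs_I 0 1 1 (pi / 2) (pi / 2) (-1) 1 0 (- \<i>) \<i> 0 (- 1)"
    by (simp add: coeffs_I_def)
  then have two: "\<exists>a b c \<phi> \<psi> s t. coeffs_I a b c \<phi> \<psi> s t 0 (- \<i>) \<i> 0 (- 1)" by blast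
  have table_one: "table_I 1 0 0 1 1 I_op"
    using table_star_I[of 1 0 0 1] by (simp add: I_op_eq)
  have I_op: "I_op \<in> stars_I"
    unfolding stars_I_eq I_op_eq using involutive_coeffs_def[of 1 0 0 1] by auto
  let ?\<Gamma> = "star_I 0 (- \<i>) \<i> 0"
  have mem: "?\<Gamma> \<in> stars_I"
    unfolding stars_I_eq using involutive_coeffs_def[of 0 "- \<i>" \<i> 0] by auto
  have table: "table_I 0 (- \<i>) \<i> 0 (- 1) ?\<Gamma>"
    using table_star_I[of 0 "- \<i>" \<i> 0] by simp
  have gens: "?\<Gamma> K = K" "?\<Gamma> E = \<i> *\<^sub>C (K * F)" "?\<Gamma> F = \<i> *\<^sub>C (E * Kinv)"
    by (simp_all add: star_I_gens H1i_arith)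
  have "?\<Gamma> e0 = e0 \<and> ?\<Gamma> E0 = (- \<i>) *\<^sub>C F1 \<and> ?\<Gamma> F0 = \<i> *\<^sub>C E1 \<and> ?\<Gamma> C0 = - C0 \<and>
      ?\<Gamma> e1 = e1 \<and> ?\<Gamma> E1 = \<i> *\<^sub>C F0 \<and> ?\<Gamma> F1 = (- \<i>) *\<^sub>C E0 \<and> ?\<Gamma> C1 = - C1"
    using table by (simp add: table_I_def scaleC_minus_left)
  with mem table gens
  have ex: "\<exists>\<Gamma>\<in>stars_I. table_I 0 (- \<i>) \<i> 0 (- 1) \<Gamma> \<and>
        \<Gamma> e0 = e0 \<and> \<Gamma> E0 = (- \<i>) *\<^sub>C F1 \<and> \<Gamma> F0 = \<i> *\<^sub>C E1 \<and> \<Gamma> C0 = - C0 \<and>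
        \<Gamma> e1 = e1 \<and> \<Gamma> E1 = \<i> *\<^sub>C F0 \<and> \<Gamma> F1 = (- \<i>) *\<^sub>C E0 \<and> \<Gamma> C1 = - C1 \<and>
        \<Gamma> K = K \<and> \<Gamma> E = \<i> *\<^sub>C (K * F) \<and> \<Gamma> F = \<i> *\<^sub>C (E * Kinv)"
    by blast
  show ?thesis
    by (intro conjI semi_hopf_stars stars_I_AutS_I stars_II_AutS_II hopf_stars family_I_bij one two
        I_op table_one ex allI impI ballI)
      (erule coeffs_I_mu I II stars_I_comult_compatible stars_II_not_comult_compatible
        | erule stars_I_orbit, assumption)+
qed

end
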